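(* Let $G$ be a first-order expansion of a group which is distal, and let $\varphi(x)$ be a formula in one variable with parameters from $G$. (a) If $\varphi(x)$ has the finitary productset property, then it has the definable finitary productset property. (b) Suppose $G$ eliminates $\exists^\infty$. Then there is $n\in\mathbb{N}$ such that if there are $B,C\subseteq G$ with $|B|,|C|\geq n$ and $B\cdot C\subseteq\varphi(G)$, then $\varphi(x)$ has the definable productset property.
   Context: Distality is in the sense of P. Simon. $\varphi(x)$ has the finitary productset property if for every $n\in\mathbb{N}$ there are $B,C\subseteq G$ with $|B|,|C|\geq n$ and $B\cdot C\subseteq\varphi(G)$. It has the definable finitary productset property if there are formulas $\theta_1(x,\bar{w}),\theta_2(x,\bar{w})$ such that for every $n\in\mathbb{N}$ there are $\bar{c}_1,\bar{c}_2\in G^{|\bar{w}|}$ with $|\theta_1(G,\bar{c}_1)|,|\theta_2(G,\bar{c}_2)|\geq n$ and $\theta_1(G,\bar{c}_1)\cdot\theta_2(G,\bar{c}_2)\subseteq\varphi(G)$. It has the definable productset property if there are infinite definable $B,C\subseteq G$ with $B\cdot C\subseteq\varphi(G)$. $G$ eliminates $\exists^\infty$ if for every formula $\theta(x,\bar{w})$ there is $n$ such that for all $\bar{c}$, if $|\theta(G,\bar{c})|\geq n$ then $\theta(G,\bar{c})$ is infinite. *)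

theory Defs
  imports Complex_Main "HOL-Algebra.Coset"
begin

text \<open>First-order languages are single-sorted, with equality, and of arbitrary cardinality.
  Variables are natural numbers.\<close>

record ('f, 'r) lang =
  fsyms :: "'f set"
  rsyms :: "'r set"
  farity :: "'f \<Rightarrow> nat"
  rarity :: "'r \<Rightarrow> nat"

datatype 'f tm = Var nat | App 'f "'f tm list"

datatype ('f, 'r) fm =
    Equal "'f tm" "'f tm"
  | Rel 'r "'f tm list"
  | Neg "('f, 'r) fm"
  | Conj "('f, 'r) fm" "('f, 'r) fm"
  | Exists nat "('f, 'r) fm"

fun wf_tm :: "('f, 'r) lang \<Rightarrow> 'f tm \<Rightarrow> bool" where
  "wf_tm L (Var i) \<longleftrightarrow> True"
| "wf_tm L (App f ts) \<longleftrightarrow> f \<in> fsyms L \<and> length ts = farity L f \<and> (\<forall>t\<in>set ts. wf_tm L t)"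

fun wf_fm :: "('f, 'r) lang \<Rightarrow> ('f, 'r) fm \<Rightarrow> bool" where
  "wf_fm L (Equal s t) \<longleftrightarrow> wf_tm L s \<and> wf_tm L t"
| "wf_fm L (Rel r ts) \<longleftrightarrow> r \<in> rsyms L \<and> length ts = rarity L r \<and> (\<forall>t\<in>set ts. wf_tm L t)"
| "wf_fm L (Neg p) \<longleftrightarrow> wf_fm L p"
| "wf_fm L (Conj p q) \<longleftrightarrow> wf_fm L p \<and> wf_fm L q"
| "wf_fm L (Exists i p) \<longleftrightarrow> wf_fm L p"

fun fv_tm :: "'f tm \<Rightarrow> nat set" where
  "fv_tm (Var i) = {i}"
| "fv_tm (App f ts) = (\<Union>t\<in>set ts. fv_tm t)"

fun fv :: "('f, 'r) fm \<Rightarrow> nat set" where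
  "fv (Equal s t) = fv_tm s \<union> fv_tm t"
| "fv (Rel r ts) = (\<Union>t\<in>set ts. fv_tm t)"
| "fv (Neg p) = fv p"
| "fv (Conj p q) = fv p \<union> fv q"
| "fv (Exists i p) = fv p - {i}"

text \<open>\<open>formula L n p\<close>: \<open>p\<close> is a (parameter-free) \<open>L\<close>-formula in the variables
  \<open>0, \<dots>, n - 1\<close>; for \<open>n = 0\<close> it is a sentence.\<close>

definition formula :: "('f, 'r) lang \<Rightarrow> nat \<Rightarrow> ('f, 'r) fm \<Rightarrow> bool" where
  "formula L n p \<longleftrightarrow> wf_fm L p \<and> fv p \<subseteq> {..<n}"

record ('f, 'r, 'a) struct =
  Dom :: "'a set"
  fint :: "'f \<Rightarrow> 'a list \<Rightarrow> 'a"
  rint :: "'r \<Rightarrow> 'a list \<Rightarrow> bool"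

definition tuples :: "('f, 'r, 'a) struct \<Rightarrow> nat \<Rightarrow> 'a list set" where
  "tuples M n = {xs. length xs = n \<and> set xs \<subseteq> Dom M}"

definition wf_struct :: "('f, 'r) lang \<Rightarrow> ('f, 'r, 'a) struct \<Rightarrow> bool" where
  "wf_struct L M \<longleftrightarrow> Dom M \<noteq> {} \<and>
     (\<forall>f\<in>fsyms L. \<forall>xs\<in>tuples M (farity L f). fint M f xs \<in> Dom M)"

fun eval :: "('f, 'r, 'a) struct \<Rightarrow> (nat \<Rightarrow> 'a) \<Rightarrow> 'f tm \<Rightarrow> 'a" where
  "eval M v (Var i) = v i"
| "eval M v (App f ts) = fint M f (map (eval M v) ts)"

fun sat :: "('f, 'r, 'a) struct \<Rightarrow> (nat \<Rightarrow> 'a) \<Rightarrow> ('f, 'r) fm \<Rightarrow> bool" where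
  "sat M v (Equal s t) \<longleftrightarrow> eval M v s = eval M v t"
| "sat M v (Rel r ts) \<longleftrightarrow> rint M r (map (eval M v) ts)"
| "sat M v (Neg p) \<longleftrightarrow> \<not> sat M v p"
| "sat M v (Conj p q) \<longleftrightarrow> sat M v p \<and> sat M v q"
| "sat M v (Exists i p) \<longleftrightarrow> (\<exists>a\<in>Dom M. sat M (v(i := a)) p)"

text \<open>\<open>holds M p xs\<close>: \<open>M\<close> satisfies \<open>p\<close> when variable \<open>i\<close> is assigned the \<open>i\<close>-th entry of
  \<open>xs\<close>. It is only used for \<open>formula L (length xs) p\<close>, so the values at the other variables
  (\<open>nth\<close> is underspecified there) play no role.\<close>

definition holds :: "('f, 'r, 'a) struct \<Rightarrow> ('f, 'r) fm \<Rightarrow> 'a list \<Rightarrow> bool" where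
  "holds M p xs \<longleftrightarrow> sat M (\<lambda>i. xs ! i) p"

text \<open>For \<open>p(x, w)\<close> with \<open>x\<close> the variable \<open>0\<close>, and a tuple \<open>c\<close> of parameters for \<open>w\<close>,
  \<open>defset M p c\<close> is the definable set \<open>p(M, c)\<close>.\<close>

definition defset :: "('f, 'r, 'a) struct \<Rightarrow> ('f, 'r) fm \<Rightarrow> 'a list \<Rightarrow> 'a set" where
  "defset M p c = {x \<in> Dom M. holds M p (x # c)}"

definition elem_equiv :: "('f, 'r) lang \<Rightarrow> ('f, 'r, 'a) struct \<Rightarrow> ('f, 'r, 'b) struct \<Rightarrow> bool" where
  "elem_equiv L M N \<longleftrightarrow> (\<forall>p. formula L 0 p \<longrightarrow> (holds M p [] \<longleftrightarrow> holds N p []))"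

text \<open>No formula \<open>p(x, y)\<close> shatters arbitrarily large finite sets of tuples. This only depends
  on the theory of \<open>M\<close>.\<close>

definition NIP :: "('f, 'r) lang \<Rightarrow> ('f, 'r, 'a) struct \<Rightarrow> bool" where
  "NIP L M \<longleftrightarrow> (\<forall>k l p. formula L (k + l) p \<longrightarrow>
     \<not> (\<forall>n::nat. \<exists>(a :: nat \<Rightarrow> 'a list) (b :: nat set \<Rightarrow> 'a list).
          (\<forall>i<n. a i \<in> tuples M k) \<and> (\<forall>S\<subseteq>{..<n}. b S \<in> tuples M l) \<and>
          (\<forall>i<n. \<forall>S\<subseteq>{..<n}. holds M p (a i @ b S) \<longleftrightarrow> i \<in> S)))"

text \<open>The sequence \<open>s\<close> of \<open>n\<close>-tuples, indexed by \<open>J\<close>, is indiscernible (over the empty set).\<close>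

definition indiscernible ::
  "('f, 'r) lang \<Rightarrow> ('f, 'r, 'a) struct \<Rightarrow> nat \<Rightarrow> 'i::linorder set \<Rightarrow> ('i \<Rightarrow> 'a list) \<Rightarrow> bool" where
  "indiscernible L M n J s \<longleftrightarrow> (\<forall>i\<in>J. s i \<in> tuples M n) \<and>
     (\<forall>is js p. sorted_wrt (<) is \<and> sorted_wrt (<) js \<and> length is = length js \<and>
        set is \<subseteq> J \<and> set js \<subseteq> J \<and> formula L (length is * n) p \<longrightarrow>
        (holds M p (concat (map s is)) \<longleftrightarrow> holds M p (concat (map s js))))"

text \<open>Distality in the sense of Simon: the theory is NIP and, whenever
  \<open>I\<^sub>1 + I\<^sub>2 + I\<^sub>3\<close> is a dense indiscernible sequence of tuples cut at two distinct Dedekind cuts,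
  if \<open>I\<^sub>1 + a + I\<^sub>2 + I\<^sub>3\<close> and \<open>I\<^sub>1 + I\<^sub>2 + b + I\<^sub>3\<close> are indiscernible then so is
  \<open>I\<^sub>1 + a + I\<^sub>2 + b + I\<^sub>3\<close>.

  Here \<open>s\<close> is the last of these sequences, indexed by the rationals, with \<open>a = s 0\<close>,
  \<open>b = s 1\<close>, and \<open>I\<^sub>1, I\<^sub>2, I\<^sub>3\<close> its restrictions to the indices \<open>q < 0\<close>, \<open>0 < q < 1\<close>,
  \<open>1 < q\<close>. Other dense orders give nothing new: indiscernibility involves finitely
  many indices at a time, so a failure is already visible on countable dense suborders without
  endpoints of \<open>I\<^sub>1, I\<^sub>2, I\<^sub>3\<close>, and those are isomorphic to the three intervals above.

  The ambient model is an arbitrary model of the theory of \<open>M\<close>, instead of a monster model.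
  Since one cannot quantify over types, its elements are taken from the type \<open>univ\<close>. This is no
  restriction: by downward Loewenheim-Skolem a failure in any model occurs in one with at most
  as many elements as there are formulas, and \<open>univ\<close> has room for it if \<open>M\<close> is infinite; if
  \<open>M\<close> is finite, all models are isomorphic to \<open>M\<close>, which also fits into \<open>univ\<close>.\<close>

type_synonym ('f, 'r, 'a) univ = "('f, 'r) fm set \<Rightarrow> 'a"

definition distal :: "('f, 'r) lang \<Rightarrow> ('f, 'r, 'a) struct \<Rightarrow> bool" where
  "distal L M \<longleftrightarrow> NIP L M \<and>
     (\<forall>N :: ('f, 'r, ('f, 'r, 'a) univ) struct. wf_struct L N \<and> elem_equiv L M N \<longrightarrow>
        (\<forall>n (s :: rat \<Rightarrow> ('f, 'r, 'a) univ list).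
           indiscernible L N n (- {1}) s \<and> indiscernible L N n (- {0}) s \<longrightarrow>
           indiscernible L N n UNIV s))"

text \<open>\<open>M\<close> is an \<open>L\<close>-structure expanding the group \<open>G\<close>, with multiplication named by the symbol
  \<open>mu\<close>. The identity and inversion may or may not be named by symbols; they are definable
  without parameters in any case.\<close>

definition group_expansion ::
  "('f, 'r) lang \<Rightarrow> ('f, 'r, 'a) struct \<Rightarrow> 'f \<Rightarrow> ('a, 'b) monoid_scheme \<Rightarrow> bool" where
  "group_expansion L M mu G \<longleftrightarrow> group G \<and> wf_struct L M \<and> Dom M = carrier G \<and>
     mu \<in> fsyms L \<and> farity L mu = 2 \<and>
     (\<forall>x\<in>carrier G. \<forall>y\<in>carrier G. fint M mu [x, y] = x \<otimes>\<^bsub>G\<^esub> y)"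

definition has_at_least :: "'a set \<Rightarrow> nat \<Rightarrow> bool" where
  "has_at_least B n \<longleftrightarrow> infinite B \<or> n \<le> card B"

text \<open>In the following, \<open>P\<close> stands for the set defined by the formula under consideration.\<close>

definition finitary_productset :: "('a, 'b) monoid_scheme \<Rightarrow> 'a set \<Rightarrow> bool" where
  "finitary_productset G P \<longleftrightarrow>
     (\<forall>n. \<exists>B C. B \<subseteq> carrier G \<and> C \<subseteq> carrier G \<and> has_at_least B n \<and> has_at_least C n \<and>
        B <#>\<^bsub>G\<^esub> C \<subseteq> P)"

definition definable_finitary_productset ::
  "('f, 'r) lang \<Rightarrow> ('f, 'r, 'a) struct \<Rightarrow> ('a, 'b) monoid_scheme \<Rightarrow> 'a set \<Rightarrow> bool" where
  "definable_finitary_productset L M G P \<longleftrightarrow>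
     (\<exists>k \<theta>\<^sub>1 \<theta>\<^sub>2. formula L (Suc k) \<theta>\<^sub>1 \<and> formula L (Suc k) \<theta>\<^sub>2 \<and>
        (\<forall>n. \<exists>c\<^sub>1\<in>tuples M k. \<exists>c\<^sub>2\<in>tuples M k.
           has_at_least (defset M \<theta>\<^sub>1 c\<^sub>1) n \<and> has_at_least (defset M \<theta>\<^sub>2 c\<^sub>2) n \<and>
           defset M \<theta>\<^sub>1 c\<^sub>1 <#>\<^bsub>G\<^esub> defset M \<theta>\<^sub>2 c\<^sub>2 \<subseteq> P))"

text \<open>Definable means definable with parameters.\<close>

definition definable :: "('f, 'r) lang \<Rightarrow> ('f, 'r, 'a) struct \<Rightarrow> 'a set \<Rightarrow> bool" where
  "definable L M B \<longleftrightarrow> (\<exists>k \<psi>. \<exists>c\<in>tuples M k. formula L (Suc k) \<psi> \<and> B = defset M \<psi> c)"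

definition definable_productset ::
  "('f, 'r) lang \<Rightarrow> ('f, 'r, 'a) struct \<Rightarrow> ('a, 'b) monoid_scheme \<Rightarrow> 'a set \<Rightarrow> bool" where
  "definable_productset L M G P \<longleftrightarrow>
     (\<exists>B C. definable L M B \<and> definable L M C \<and> infinite B \<and> infinite C \<and> B <#>\<^bsub>G\<^esub> C \<subseteq> P)"

definition eliminates_exists_infinity :: "('f, 'r) lang \<Rightarrow> ('f, 'r, 'a) struct \<Rightarrow> bool" where
  "eliminates_exists_infinity L M \<longleftrightarrow>
     (\<forall>k \<theta>. formula L (Suc k) \<theta> \<longrightarrow>
        (\<exists>n. \<forall>c\<in>tuples M k. has_at_least (defset M \<theta> c) n \<longrightarrow> infinite (defset M \<theta> c)))"

end

theory Submission
  imports Defs "HOL-Library.Ramsey" "HOL-Library.Countable"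
begin

text \<open>Write \<open>E x y\<close> for \<open>x y \<in> \<phi>(G)\<close> and suppose that \<open>E\<close> contains arbitrarily large finite
  rectangles \<open>B \<times> C\<close> but no uniformly definable family of such rectangles. By Ramsey's theorem \<open>C\<close>
  contains a long \<open>\<Delta>\<close>-indiscernible sequence; keep a few of its elements, separated by large
  gaps. For a gap \<open>m\<close>, let \<open>Y\<^sub>m\<close> be the set of all elements that fill it \<open>\<Delta>\<close>-indiscernibly. It
  is uniformly definable and large, so its set of common neighbours
  \<open>X\<^sub>m = {x. \<forall>y\<in>Y\<^sub>m. E x y}\<close> is bounded in size, and some \<open>b \<in> B\<close> avoids \<open>X\<^sub>m\<close> for each of
  the finitely many gaps \<open>m\<close> considered. Such a \<open>b\<close> is related to
  all elements that were kept, but in every gap there is an element that fits into it and is not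
  related to \<open>b\<close>.

  By compactness this is realised in a model of the theory by a fully indiscernible dense sequence.
  Distality allows all gaps to be filled simultaneously, and then \<open>E b\<close> alternates along an
  indiscernible sequence as often as we like, contradicting NIP. Part (b) follows from (a).\<close>

section \<open>Ultrapowers and compactness\<close>

definition ultrafilter :: "'i filter \<Rightarrow> bool" where
  "ultrafilter U \<longleftrightarrow> U \<noteq> bot \<and> (\<forall>P. \<not> eventually P U \<longleftrightarrow> eventually (\<lambda>x. \<not> P x) U)"

text \<open>Zorn's lemma for the proper filters below \<open>F\<close>, where smaller means finer. A
  chain is directed, so a property holds eventually along its infimum iff it does along some member,
  and the infimum stays proper. A minimal proper filter decides every \<open>P\<close>: if
  \<open>P\<close> is not eventually true, restricting to the complement of \<open>P\<close> gives a
  proper finer filter, which by minimality is the same one.\<close>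

lemma ultrafilter_refinement:
  fixes F :: "'i filter"
  assumes "F \<noteq> bot"
  obtains U where "U \<le> F" "ultrafilter U"
proof -
  define \<F> where "\<F> = {G. G \<noteq> bot \<and> G \<le> F}"
  have "\<exists>U\<in>\<F>. \<forall>G\<in>\<F>. G \<le> U \<longrightarrow> G = U"
  proof (rule predicate_Zorn)
    show "partial_order_on \<F> (relation_of (\<lambda>x y. y \<le> x) \<F>)"
      by (rule partial_order_on_relation_ofI) auto
  next
    fix \<C> assume \<C>: "\<C> \<in> Chains (relation_of (\<lambda>x y. y \<le> x) \<F>)"
    have sub: "\<C> \<subseteq> \<F>" and ch: "\<And>G H. G \<in> \<C> \<Longrightarrow> H \<in> \<C> \<Longrightarrow> G \<le> H \<or> H \<le> G"
      using \<C> by (auto simp: Chains_def relation_of_def)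
    show "\<exists>u\<in>\<F>. \<forall>a\<in>\<C>. u \<le> a"
    proof (cases "\<C> = {}")
      case True
      then show ?thesis using assms by (auto simp: \<F>_def)
    next
      case False
      have "eventually P (Inf \<C>) \<longleftrightarrow> (\<exists>G\<in>\<C>. eventually P G)" for P
      proof (rule eventually_Inf_base[OF False])
        fix G H assume "G \<in> \<C>" "H \<in> \<C>"
        then show "\<exists>x\<in>\<C>. x \<le> inf G H"
          using ch[of G H] by (auto intro: bexI[of _ G] bexI[of _ H])
      qed
      then have "Inf \<C> \<noteq> bot"
        using sub unfolding trivial_limit_def \<F>_def by auto
      moreover have "Inf \<C> \<le> F"
        using False sub by (auto simp: \<F>_def intro: Inf_lower2)
      ultimately show ?thesis
        by (intro bexI[of _ "Inf \<C>"]) (auto simp: \<F>_def Inf_lower)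
    qed
  qed
  then obtain U where U: "U \<noteq> bot" "U \<le> F" and max: "\<And>G. G \<in> \<F> \<Longrightarrow> G \<le> U \<Longrightarrow> G = U"
    by (auto simp: \<F>_def)
  have "\<not> eventually P U \<longleftrightarrow> eventually (\<lambda>x. \<not> P x) U" for P
  proof
    assume "\<not> eventually P U"
    then have "inf U (principal {x. \<not> P x}) \<noteq> bot"
      by (simp add: trivial_limit_def eventually_inf_principal)
    moreover have "inf U (principal {x. \<not> P x}) \<le> F"
      using U by (meson inf.cobounded1 order_trans)
    ultimately have eq: "inf U (principal {x. \<not> P x}) = U"
      by (intro max) (auto simp: \<F>_def)
    show "eventually (\<lambda>x. \<not> P x) U"
      by (subst eq[symmetric]) (simp add: eventually_inf_principal)
  next
    assume a: "eventually (\<lambda>x. \<not> P x) U"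
    show "\<not> eventually P U"
    proof
      assume "eventually P U"
      with a have "eventually (\<lambda>x. False) U" by eventually_elim simp
      with U show False by (simp add: trivial_limit_def)
    qed
  qed
  with U that show thesis unfolding ultrafilter_def by blast
qed

section \<open>Ultrapowers and the theorem of Los\<close>

lemma eval_cong: "(\<And>i. i \<in> fv_tm t \<Longrightarrow> v i = w i) \<Longrightarrow> eval M v t = eval M w t"
proof (induction t)
  case (App f ts)
  then have "map (eval M v) ts = map (eval M w) ts"
    by (fastforce intro!: map_cong)
  then show ?case by (simp only: eval.simps)
qed simp

lemma sat_cong: "(\<And>i. i \<in> fv p \<Longrightarrow> v i = w i) \<Longrightarrow> sat M v p \<longleftrightarrow> sat M w p"
proof (induction p arbitrary: v w)
  case (Equal s t)
  then show ?case using eval_cong[of s v w M] eval_cong[of t v w M] by auto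
next
  case (Rel r ts)
  then have "map (eval M v) ts = map (eval M w) ts"
    by (auto intro!: eval_cong)
  then show ?case by (simp only: sat.simps)
next
  case (Exists i p)
  have "sat M (v(i := a)) p \<longleftrightarrow> sat M (w(i := a)) p" for a
    using Exists.prems by (intro Exists.IH) auto
  then show ?case by simp
next
  case (Neg p)
  then show ?case by (metis fv.simps(3) sat.simps(3))
next
  case (Conj p q)
  have "sat M v p = sat M w p" by (rule Conj.IH(1)) (use Conj.prems in auto)
  moreover have "sat M v q = sat M w q" by (rule Conj.IH(2)) (use Conj.prems in auto)
  ultimately show ?case by simp
qed

lemma holds_nil: "formula L 0 p \<Longrightarrow> holds M p [] \<longleftrightarrow> sat M v p"
  unfolding holds_def formula_def by (rule sat_cong) auto

lemma eval_in_Dom: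
  assumes "wf_struct L M" "wf_tm L t" "\<And>i. v i \<in> Dom M"
  shows "eval M v t \<in> Dom M"
  using assms(2)
proof (induction t)
  case (App f ts)
  then have "map (eval M v) ts \<in> tuples M (farity L f)"
    by (auto simp: tuples_def)
  with App assms(1) show ?case by (auto simp: wf_struct_def)
qed (use assms(3) in simp)

locale ultrapower =
  fixes L :: "('f, 'r) lang" and M :: "('f, 'r, 'a) struct" and U :: "'i filter"
  assumes wf: "wf_struct L M"
    and ultrafilter: "ultrafilter U"
begin

lemma proper: "U \<noteq> bot"
  and ultra: "\<not> eventually P U \<longleftrightarrow> eventually (\<lambda>x. \<not> P x) U"
  using ultrafilter by (auto simp only: ultrafilter_def)

text \<open>A class of functions modulo \<open>U\<close> is replaced by one chosen member with
  values in \<open>Dom M\<close>. The choice depends on the class only, so equality in the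
  ultrapower is equality of functions and its elements are plain functions on the index
  type.\<close>

definition rep :: "('i \<Rightarrow> 'a) \<Rightarrow> 'i \<Rightarrow> 'a" where
  "rep f = (SOME g. range g \<subseteq> Dom M \<and> eventually (\<lambda>S. g S = f S) U)"

definition upower :: "('f, 'r, 'i \<Rightarrow> 'a) struct" where
  "upower = \<lparr> Dom = rep ` {f. range f \<subseteq> Dom M},
     fint = (\<lambda>f xs. rep (\<lambda>S. fint M f (map (\<lambda>x. x S) xs))),
     rint = (\<lambda>r xs. eventually (\<lambda>S. rint M r (map (\<lambda>x. x S) xs)) U) \<rparr>"

lemma rep_spec:
  assumes "range f \<subseteq> Dom M"
  shows "range (rep f) \<subseteq> Dom M" "eventually (\<lambda>S. rep f S = f S) U"
proof -
  have "\<exists>g. range g \<subseteq> Dom M \<and> eventually (\<lambda>S. g S = f S) U"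
    using assms by (intro exI[of _ f]) auto
  from someI_ex[OF this] show "range (rep f) \<subseteq> Dom M" "eventually (\<lambda>S. rep f S = f S) U"
    by (auto simp: rep_def)
qed

lemma rep_cong: "eventually (\<lambda>S. f S = g S) U \<Longrightarrow> rep f = rep g"
proof -
  assume e: "eventually (\<lambda>S. f S = g S) U"
  have "eventually (\<lambda>S. h S = f S) U \<longleftrightarrow> eventually (\<lambda>S. h S = g S) U" for h
    using e by (intro eventually_subst) (auto elim: eventually_mono)
  then show "rep f = rep g" by (simp add: rep_def)
qed

lemma Dom_upower: "f \<in> Dom upower \<Longrightarrow> range f \<subseteq> Dom M" "f \<in> Dom upower \<Longrightarrow> rep f = f"
  by (auto simp: upower_def intro: rep_cong rep_spec dest: rep_spec(1))

lemma rep_in_Dom: "range f \<subseteq> Dom M \<Longrightarrow> rep f \<in> Dom upower"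
  by (auto simp: upower_def)

lemma wf_upower: "wf_struct L upower"
proof -
  obtain a where a: "a \<in> Dom M" using wf by (auto simp: wf_struct_def)
  then have "rep (\<lambda>_. a) \<in> Dom upower" by (intro rep_in_Dom) auto
  moreover have "fint upower f xs \<in> Dom upower"
    if f: "f \<in> fsyms L" and xs: "xs \<in> tuples upower (farity L f)" for f xs
  proof -
    have "map (\<lambda>x. x S) xs \<in> tuples M (farity L f)" for S
      using xs Dom_upower(1) by (fastforce simp: tuples_def)
    then have "rep (\<lambda>S. fint M f (map (\<lambda>x. x S) xs)) \<in> Dom upower"
      using wf f by (intro rep_in_Dom) (auto simp: wf_struct_def)
    then show ?thesis by (simp add: upower_def)
  qed
  ultimately show ?thesis by (auto simp: wf_struct_def)
qed

lemma eval_upower: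
  assumes v: "\<And>i. v i \<in> Dom upower" and "wf_tm L t"
  shows "eval upower v t = rep (\<lambda>S. eval M (\<lambda>i. v i S) t)"
  using assms(2)
proof (induction t)
  case (Var i)
  then show ?case using Dom_upower(2)[OF v[of i]] by simp
next
  case (App f ts)
  have v': "v i S \<in> Dom M" for i S using Dom_upower(1)[OF v] by auto
  have "\<forall>t\<in>set ts. eventually (\<lambda>S. eval upower v t S = eval M (\<lambda>i. v i S) t) U"
    using App eval_in_Dom[OF wf _ v'] by (auto simp: image_subset_iff intro!: rep_spec(2))
  then have "eventually (\<lambda>S. \<forall>t\<in>set ts. eval upower v t S = eval M (\<lambda>i. v i S) t) U"
    by (simp add: eventually_ball_finite)
  then have "eventually (\<lambda>S. fint M f (map (\<lambda>x. x S) (map (eval upower v) ts))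
      = eval M (\<lambda>i. v i S) (App f ts)) U"
    by eventually_elim (auto intro!: arg_cong[where f="fint M f"])
  then show ?case
    by (auto simp: upower_def intro: rep_cong)
qed

lemma eval_upower_eventually:
  assumes v: "\<And>i. v i \<in> Dom upower" and "wf_tm L t"
  shows "eventually (\<lambda>S. eval upower v t S = eval M (\<lambda>i. v i S) t) U"
  unfolding eval_upower[OF assms]
proof (rule rep_spec(2))
  have "v i S \<in> Dom M" for i S using Dom_upower(1)[OF v] by auto
  then show "range (\<lambda>S. eval M (\<lambda>i. v i S) t) \<subseteq> Dom M"
    using eval_in_Dom[OF wf assms(2)] by auto
qed

text \<open>Induction on the formula. Negation is where \<open>U\<close> has to be an ultrafilter
  and not just a filter; for the quantifier, witnesses are chosen index by index and then passed
  through \<open>rep\<close>, which alters them only on a set negligible for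
  \<open>U\<close>.\<close>

theorem Los:
  assumes "\<And>i. v i \<in> Dom upower" and "wf_fm L p"
  shows "sat upower v p \<longleftrightarrow> eventually (\<lambda>S. sat M (\<lambda>i. v i S) p) U"
  using assms
proof (induction p arbitrary: v)
  case (Equal s t)
  have st: "eventually (\<lambda>S. eval upower v s S = eval M (\<lambda>i. v i S) s) U"
    "eventually (\<lambda>S. eval upower v t S = eval M (\<lambda>i. v i S) t) U"
    using Equal by (auto intro: eval_upower_eventually)
  show ?case
  proof
    assume "sat upower v (Equal s t)"
    then have "eval upower v s = eval upower v t" by simp
    with st(1) have "eventually (\<lambda>S. eval upower v t S = eval M (\<lambda>i. v i S) s) U" by simp
    with st(2) show "eventually (\<lambda>S. sat M (\<lambda>i. v i S) (Equal s t)) U"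
      by eventually_elim simp
  next
    assume "eventually (\<lambda>S. sat M (\<lambda>i. v i S) (Equal s t)) U"
    then show "sat upower v (Equal s t)"
      using Equal by (auto simp: eval_upower intro: rep_cong)
  qed
next
  case (Rel r ts)
  have "\<forall>t\<in>set ts. eventually (\<lambda>S. eval upower v t S = eval M (\<lambda>i. v i S) t) U"
    using Rel by (auto intro: eval_upower_eventually)
  then have "eventually (\<lambda>S. \<forall>t\<in>set ts. eval upower v t S = eval M (\<lambda>i. v i S) t) U"
    by (simp add: eventually_ball_finite)
  then have "eventually (\<lambda>S. map (\<lambda>x. x S) (map (eval upower v) ts) = map (eval M (\<lambda>i. v i S)) ts) U"
    by eventually_elim auto
  then have "eventually (\<lambda>S. rint M r (map (\<lambda>x. x S) (map (eval upower v) ts))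
      \<longleftrightarrow> rint M r (map (eval M (\<lambda>i. v i S)) ts)) U"
    by eventually_elim metis
  then have "eventually (\<lambda>S. rint M r (map (\<lambda>x. x S) (map (eval upower v) ts))) U
     \<longleftrightarrow> eventually (\<lambda>S. rint M r (map (eval M (\<lambda>i. v i S)) ts)) U"
    by (rule eventually_subst)
  then show ?case by (simp add: upower_def)
next
  case (Neg p)
  then show ?case by (simp flip: ultra)
next
  case (Conj p q)
  then show ?case by (simp add: eventually_conj_iff)
next
  case (Exists i p)
  have upd: "(\<lambda>j. (v(i := f)) j S) = (\<lambda>j. v j S)(i := f S)" for f S by auto
  have step: "sat upower (v(i := f)) p \<longleftrightarrow> eventually (\<lambda>S. sat M ((\<lambda>j. v j S)(i := f S)) p) U"
    if "f \<in> Dom upower" for f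
    using Exists.IH[of "v(i := f)"] Exists.prems that by (simp add: upd del: fun_upd_apply) (simp add: fun_upd_apply)
  show ?case
  proof
    assume "sat upower v (Exists i p)"
    then obtain f where f: "f \<in> Dom upower" and "sat upower (v(i := f)) p" by auto
    with step[OF f] have "eventually (\<lambda>S. sat M ((\<lambda>j. v j S)(i := f S)) p) U" by simp
    then show "eventually (\<lambda>S. sat M (\<lambda>i. v i S) (Exists i p)) U"
      by eventually_elim (use Dom_upower(1)[OF f] in auto)
  next
    assume *: "eventually (\<lambda>S. sat M (\<lambda>i. v i S) (Exists i p)) U"
    obtain a0 where a0: "a0 \<in> Dom M" using wf by (auto simp: wf_struct_def)
    \<comment> \<open>Indices without a witness get the default \<open>a0\<close>, so that
      \<open>g\<close> has all its values in \<open>Dom M\<close> and \<open>rep g\<close> is an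
      element of the ultrapower.\<close>
    define g where "g S = (if \<exists>a\<in>Dom M. sat M ((\<lambda>j. v j S)(i := a)) p
       then SOME a. a \<in> Dom M \<and> sat M ((\<lambda>j. v j S)(i := a)) p else a0)" for S
    have g: "g S \<in> Dom M" "(\<exists>a\<in>Dom M. sat M ((\<lambda>j. v j S)(i := a)) p) \<Longrightarrow> sat M ((\<lambda>j. v j S)(i := g S)) p" for S
    proof -
      have "(\<exists>a\<in>Dom M. sat M ((\<lambda>j. v j S)(i := a)) p) \<Longrightarrow> g S \<in> Dom M \<and> sat M ((\<lambda>j. v j S)(i := g S)) p"
        by (simp add: g_def) (rule someI_ex, blast)
      then show "g S \<in> Dom M" "(\<exists>a\<in>Dom M. sat M ((\<lambda>j. v j S)(i := a)) p) \<Longrightarrow> sat M ((\<lambda>j. v j S)(i := g S)) p"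
        using a0 by (auto simp: g_def)
    qed
    have rg: "range g \<subseteq> Dom M" using g(1) by auto
    have "eventually (\<lambda>S. sat M ((\<lambda>j. v j S)(i := rep g S)) p) U"
      using * rep_spec(2)[OF rg] by eventually_elim (simp add: g(2))
    then have "sat upower (v(i := rep g)) p"
      using step[OF rep_in_Dom[OF rg]] by simp
    then show "sat upower v (Exists i p)" using rep_in_Dom[OF rg] by auto
  qed
qed

end

text \<open>The ultrapower is indexed by the finite subsets of \<open>\<Gamma>\<close>, so its elements, being
  represented by functions on the index set, live in the type \<open>univ\<close> over which \<open>distal\<close>
  quantifies.\<close>

theorem compactness:
  fixes L :: "('f, 'r) lang" and M :: "('f, 'r, 'a) struct"
  assumes wf: "wf_struct L M" and \<Gamma>: "\<And>p. p \<in> \<Gamma> \<Longrightarrow> wf_fm L p"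
    and fin: "\<And>S. finite S \<Longrightarrow> S \<subseteq> \<Gamma> \<Longrightarrow> \<exists>w. range w \<subseteq> Dom M \<and> (\<forall>p\<in>S. sat M w p)"
  obtains N :: "('f, 'r, ('f, 'r, 'a) univ) struct" and v
  where "wf_struct L N" "elem_equiv L M N" "range v \<subseteq> Dom N" "\<forall>p\<in>\<Gamma>. sat N v p"
proof -
  \<comment> \<open>Refining the filter of finite subsets puts any given member of \<Gamma> into
    almost every index \<open>S\<close>.\<close>
  obtain U where U: "U \<le> finite_subsets_at_top \<Gamma>" "ultrafilter U"
    by (rule ultrafilter_refinement[OF finite_subsets_at_top_neq_bot])
  interpret ultrapower L M U
    by (rule ultrapower.intro[OF wf U(2)])
  \<comment> \<open>At a finite \<open>S\<close> inside \<Gamma> the assignment realises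
    \<open>S\<close>; at all other indices any assignment into \<open>Dom M\<close> will do, and the
    case of the empty set supplies one.\<close>
  have "\<forall>S. \<exists>w. range w \<subseteq> Dom M \<and> (finite S \<and> S \<subseteq> \<Gamma> \<longrightarrow> (\<forall>p\<in>S. sat M w p))"
  proof
    fix S
    show "\<exists>w. range w \<subseteq> Dom M \<and> (finite S \<and> S \<subseteq> \<Gamma> \<longrightarrow> (\<forall>p\<in>S. sat M w p))"
    proof (cases "finite S \<and> S \<subseteq> \<Gamma>")
      case True
      with fin[of S] show ?thesis by simp
    next
      case False
      with fin[of "{}"] show ?thesis by auto
    qed
  qed
  from choice[OF this] obtain w where
    w: "\<forall>S. range (w S) \<subseteq> Dom M \<and> (finite S \<and> S \<subseteq> \<Gamma> \<longrightarrow> (\<forall>p\<in>S. sat M (w S) p))" ..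
  define v where "v i = rep (\<lambda>S. w S i)" for i
  have rng: "range (\<lambda>S. w S i) \<subseteq> Dom M" for i
    using w by (simp add: image_subset_iff)
  have v: "v i \<in> Dom upower" for i unfolding v_def by (rule rep_in_Dom[OF rng])
  have "sat upower v p" if p: "p \<in> \<Gamma>" for p
  proof -
    \<comment> \<open>\<open>rep\<close> may alter each coordinate on a negligible set of its own.
      As \<open>p\<close> has finitely many free variables, these sets can be discarded
      together.\<close>
    have "\<forall>i\<in>fv p. eventually (\<lambda>S. v i S = w S i) U"
      by (simp add: v_def rep_spec(2)[OF rng])
    moreover have "finite (fv_tm t)" for t :: "'f tm" by (induction t) auto
    then have "finite (fv p)" by (induction p) auto
    ultimately have "eventually (\<lambda>S. \<forall>i\<in>fv p. v i S = w S i) U"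
      by (simp add: eventually_ball_finite)
    moreover have "eventually (\<lambda>S. finite S \<and> S \<subseteq> \<Gamma> \<and> p \<in> S) (finite_subsets_at_top \<Gamma>)"
      unfolding eventually_finite_subsets_at_top using p by (intro exI[of _ "{p}"]) auto
    then have "eventually (\<lambda>S. finite S \<and> S \<subseteq> \<Gamma> \<and> p \<in> S) U"
      using U(1) by (auto simp: le_filter_def)
    ultimately have "eventually (\<lambda>S. sat M (\<lambda>i. v i S) p) U"
      proof eventually_elim
      case (elim S)
      then have "sat M (w S) p" using w[rule_format, of S] by simp
      then show ?case using sat_cong[of p "\<lambda>i. v i S" "w S"] elim by simp
    qed
    then show ?thesis using Los[OF v \<Gamma>[OF p]] by simp
  qed
  moreover have "elem_equiv L M upower"
    unfolding elem_equiv_def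
  proof safe
    fix p assume p: "formula L 0 p"
    have "sat M (\<lambda>i. v i S) p \<longleftrightarrow> holds M p []" for S
      by (rule holds_nil[OF p, symmetric])
    then have "sat upower v p \<longleftrightarrow> eventually (\<lambda>S. holds M p []) U"
      using Los[OF v, of p] p by (simp add: formula_def)
    then have iff: "holds upower p [] \<longleftrightarrow> holds M p []"
      using holds_nil[OF p, of upower v] proper by (simp add: eventually_const)
    { assume "holds M p []" then show "holds upower p []" using iff by simp }
    { assume "holds upower p []" then show "holds M p []" using iff by simp }
  qed
  moreover have "range v \<subseteq> Dom upower" using v by blast
  ultimately show thesis
    using that[OF wf_upower, of v] by blast
qed

section \<open>Substitution, finite conjunctions, shattering\<close>

fun ren_tm :: "(nat \<Rightarrow> nat) \<Rightarrow> 'f tm \<Rightarrow> 'f tm" where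
  "ren_tm \<rho> (Var i) = Var (\<rho> i)"
| "ren_tm \<rho> (App f ts) = App f (map (ren_tm \<rho>) ts)"

text \<open>Bound variables are renamed along with the free ones. For injective renamings this rules
  out capture, and no freshness conditions have to be tracked.\<close>

fun ren :: "(nat \<Rightarrow> nat) \<Rightarrow> ('f, 'r) fm \<Rightarrow> ('f, 'r) fm" where
  "ren \<rho> (Equal s t) = Equal (ren_tm \<rho> s) (ren_tm \<rho> t)"
| "ren \<rho> (Rel r ts) = Rel r (map (ren_tm \<rho>) ts)"
| "ren \<rho> (Neg p) = Neg (ren \<rho> p)"
| "ren \<rho> (Conj p q) = Conj (ren \<rho> p) (ren \<rho> q)"
| "ren \<rho> (Exists i p) = Exists (\<rho> i) (ren \<rho> p)"

lemma wf_ren_tm [simp]: "wf_tm L (ren_tm \<rho> t) \<longleftrightarrow> wf_tm L t"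
  by (induction t) auto

lemma wf_ren [simp]: "wf_fm L (ren \<rho> p) \<longleftrightarrow> wf_fm L p"
  by (induction p) auto

lemma fv_ren_tm: "fv_tm (ren_tm \<rho> t) = \<rho> ` fv_tm t"
  by (induction t) auto

lemma fv_ren: "inj \<rho> \<Longrightarrow> fv (ren \<rho> p) = \<rho> ` fv p"
  by (induction p) (auto simp: fv_ren_tm inj_eq)

lemma eval_ren_tm: "eval M v (ren_tm \<rho> t) = eval M (v \<circ> \<rho>) t"
proof (induction t)
  case (App f ts)
  have eq: "map (\<lambda>t. eval M v (ren_tm \<rho> t)) ts = map (eval M (v \<circ> \<rho>)) ts"
    by (rule map_cong[OF refl App.IH])
  show ?case
    by (simp only: eval.simps ren_tm.simps map_map o_def[of "eval M v" "ren_tm \<rho>"] eq)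
qed simp

lemma sat_ren: "inj \<rho> \<Longrightarrow> sat M v (ren \<rho> p) \<longleftrightarrow> sat M (v \<circ> \<rho>) p"
proof (induction p arbitrary: v)
  case (Exists i p)
  have "v(\<rho> i := a) \<circ> \<rho> = (v \<circ> \<rho>)(i := a)" for a
    using Exists.prems by (auto simp: inj_eq)
  then show ?case using Exists by (simp del: comp_apply fun_upd_apply)
qed (simp_all add: eval_ren_tm comp_def)

text \<open>An injective extension to all variables of the substitution of \<open>xs\<close> for the
  first ones: the shift by \<open>Suc (sum_list xs)\<close> moves all other variables beyond every
  entry of \<open>xs\<close>.\<close>

definition var_ren :: "nat list \<Rightarrow> nat \<Rightarrow> nat" where
  "var_ren xs i = (if i < length xs then xs ! i else i + Suc (sum_list xs))"

definition inst :: "('f, 'r) fm \<Rightarrow> nat list \<Rightarrow> ('f, 'r) fm" where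
  "inst p xs = ren (var_ren xs) p"

lemma inj_var_ren:
  assumes "distinct xs" shows "inj (var_ren xs)"
proof (rule injI)
  fix i j assume eq: "var_ren xs i = var_ren xs j"
  have "xs ! i \<le> sum_list xs" if "i < length xs" for i
    using that by (simp add: member_le_sum_list)
  then have "i < length xs \<Longrightarrow> \<not> j < length xs \<Longrightarrow> xs ! i < var_ren xs j"
    "j < length xs \<Longrightarrow> \<not> i < length xs \<Longrightarrow> xs ! j < var_ren xs i" for i j
    by (fastforce simp: var_ren_def)+
  then show "i = j"
    using eq assms by (auto simp: var_ren_def nth_eq_iff_index_eq split: if_splits)
      (metis add_Suc_right eq less_irrefl var_ren_def)+
qed

lemma wf_inst [simp]: "wf_fm L (inst p xs) \<longleftrightarrow> wf_fm L p"
  by (simp add: inst_def)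

lemma fv_inst:
  assumes "formula L (length xs) p" "distinct xs"
  shows "fv (inst p xs) \<subseteq> set xs"
  using assms by (auto simp: inst_def fv_ren inj_var_ren formula_def var_ren_def)

lemma sat_inst:
  assumes "formula L (length xs) p" "distinct xs"
  shows "sat M v (inst p xs) \<longleftrightarrow> holds M p (map v xs)"
  unfolding inst_def sat_ren[OF inj_var_ren[OF assms(2)]] holds_def
  using assms(1) by (intro sat_cong) (auto simp: formula_def var_ren_def)

definition Iff :: "('f, 'r) fm \<Rightarrow> ('f, 'r) fm \<Rightarrow> ('f, 'r) fm" where
  "Iff p q = Conj (Neg (Conj p (Neg q))) (Neg (Conj q (Neg p)))"

lemma Iff_simps [simp]:
  "sat M v (Iff p q) \<longleftrightarrow> (sat M v p \<longleftrightarrow> sat M v q)"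
  "wf_fm L (Iff p q) \<longleftrightarrow> wf_fm L p \<and> wf_fm L q"
  "fv (Iff p q) = fv p \<union> fv q"
  by (auto simp: Iff_def)

text \<open>The empty conjunction is a true sentence, so it contributes no free variables.\<close>

definition Conjs :: "('f, 'r) fm list \<Rightarrow> ('f, 'r) fm" where
  "Conjs ps = foldr Conj ps (Neg (Exists 0 (Neg (Equal (Var 0) (Var 0)))))"

lemma Conjs_simps [simp]:
  "sat M v (Conjs ps) \<longleftrightarrow> (\<forall>p\<in>set ps. sat M v p)"
  "wf_fm L (Conjs ps) \<longleftrightarrow> (\<forall>p\<in>set ps. wf_fm L p)"
  "fv (Conjs ps) = (\<Union>p\<in>set ps. fv p)"
  unfolding Conjs_def by (induction ps) auto

abbreviation Exs :: "nat list \<Rightarrow> ('f, 'r) fm \<Rightarrow> ('f, 'r) fm" where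
  "Exs xs p \<equiv> foldr Exists xs p"

lemma Exs_simps [simp]:
  "wf_fm L (Exs xs p) \<longleftrightarrow> wf_fm L p"
  "fv (Exs xs p) = fv p - set xs"
  by (induction xs) auto

lemma sat_Exs:
  "sat M v (Exs xs p) \<longleftrightarrow>
     (\<exists>w. w ` set xs \<subseteq> Dom M \<and> (\<forall>i. i \<notin> set xs \<longrightarrow> w i = v i) \<and> sat M w p)"
proof (induction xs arbitrary: v)
  case Nil
  have "(\<forall>i. w i = v i) \<longleftrightarrow> w = v" for w by auto
  then show ?case by simp
next
  case (Cons x xs)
  show ?case
  proof
    assume "sat M v (Exs (x # xs) p)"
    then obtain a w where "a \<in> Dom M" "w ` set xs \<subseteq> Dom M"
      "\<forall>i. i \<notin> set xs \<longrightarrow> w i = (v(x := a)) i" "sat M w p"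
      by (auto simp: Cons.IH)
    then show "\<exists>w. w ` set (x # xs) \<subseteq> Dom M \<and> (\<forall>i. i \<notin> set (x # xs) \<longrightarrow> w i = v i) \<and> sat M w p"
      by (intro exI[of _ w]) (cases "x \<in> set xs"; auto)
  next
    assume "\<exists>w. w ` set (x # xs) \<subseteq> Dom M \<and> (\<forall>i. i \<notin> set (x # xs) \<longrightarrow> w i = v i) \<and> sat M w p"
    then obtain w where w: "w ` set (x # xs) \<subseteq> Dom M" "\<forall>i. i \<notin> set (x # xs) \<longrightarrow> w i = v i" "sat M w p"
      by auto
    then have "sat M (v(x := w x)) (Exs xs p)"
      unfolding Cons.IH by (intro exI[of _ w]) auto
    then show "sat M v (Exs (x # xs) p)" using w(1) by auto
  qed
qed

section \<open>Shattering expressed by formulas\<close>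

definition pattern_fm :: "('f, 'r) fm \<Rightarrow> nat \<Rightarrow> nat \<Rightarrow> nat set \<Rightarrow> ('f, 'r) fm" where
  "pattern_fm p l n S = Exs [n..<n+l] (Conjs (map (\<lambda>i.
     if i \<in> S then inst p (i # [n..<n+l]) else Neg (inst p (i # [n..<n+l]))) [0..<n]))"

lemma formula_pattern_fm:
  assumes "formula L (Suc l) p"
  shows "formula L n (pattern_fm p l n S)"
proof -
  have "fv (inst p (i # [n..<n+l])) \<subseteq> insert i {n..<n+l}" if "i < n" for i
    using fv_inst[of L "i # [n..<n+l]" p] assms that by auto
  then show ?thesis
    using assms unfolding formula_def pattern_fm_def
    by (fastforce split: if_splits)
qed

lemma holds_pattern_fm:
  assumes p: "formula L (Suc l) p" and xs: "length xs = n"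
  shows "holds M (pattern_fm p l n S) xs \<longleftrightarrow>
    (\<exists>ys\<in>tuples M l. \<forall>i<n. holds M p (xs ! i # ys) \<longleftrightarrow> i \<in> S)"
proof -
  have inst: "sat M w (inst p (i # [n..<n+l])) \<longleftrightarrow> holds M p (w i # map w [n..<n+l])"
    if "i < n" for w i
    using sat_inst[of L "i # [n..<n+l]" p M w] p that by simp
  let ?C = "Conjs (map (\<lambda>i. if i \<in> S then inst p (i # [n..<n+l])
     else Neg (inst p (i # [n..<n+l]))) [0..<n])"
  have C: "sat M w ?C \<longleftrightarrow> (\<forall>i<n. holds M p (w i # map w [n..<n+l]) \<longleftrightarrow> i \<in> S)" for w
  proof -
    have "sat M w ?C \<longleftrightarrow> (\<forall>i\<in>{0..<n}. sat M w (if i \<in> S then inst p (i # [n..<n+l])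
       else Neg (inst p (i # [n..<n+l]))))"
      by (simp only: Conjs_simps set_map ball_simps set_upt)
    also have "\<dots> \<longleftrightarrow> (\<forall>i\<in>{0..<n}. holds M p (w i # map w [n..<n+l]) \<longleftrightarrow> i \<in> S)"
    proof (rule ball_cong[OF refl])
      fix i assume "i \<in> {0..<n}"
      then show "sat M w (if i \<in> S then inst p (i # [n..<n+l]) else Neg (inst p (i # [n..<n+l])))
        \<longleftrightarrow> (holds M p (w i # map w [n..<n+l]) \<longleftrightarrow> i \<in> S)"
        using inst[of i w] by (cases "i \<in> S") simp_all
    qed
    finally show ?thesis by (simp add: Ball_def)
  qed
  have "holds M (pattern_fm p l n S) xs \<longleftrightarrow>
    (\<exists>w. w ` set [n..<n+l] \<subseteq> Dom M \<and> (\<forall>i. i \<notin> set [n..<n+l] \<longrightarrow> w i = xs ! i) \<and>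
      (\<forall>i<n. holds M p (w i # map w [n..<n+l]) \<longleftrightarrow> i \<in> S))"
    by (simp only: holds_def[of M "pattern_fm p l n S"]) (simp only: pattern_fm_def sat_Exs C)
  also have "\<dots> \<longleftrightarrow> (\<exists>ys\<in>tuples M l. \<forall>i<n. holds M p (xs ! i # ys) \<longleftrightarrow> i \<in> S)"
  proof safe
    fix w assume "w ` set [n..<n+l] \<subseteq> Dom M" "\<forall>i. i \<notin> set [n..<n+l] \<longrightarrow> w i = xs ! i"
      "\<forall>i<n. holds M p (w i # map w [n..<n+l]) \<longleftrightarrow> i \<in> S"
    then show "\<exists>ys\<in>tuples M l. \<forall>i<n. holds M p (xs ! i # ys) \<longleftrightarrow> i \<in> S"
      by (intro bexI[of _ "map w [n..<n+l]"]) (simp_all add: tuples_def)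
  next
    fix ys assume ys: "ys \<in> tuples M l" "\<forall>i<n. holds M p (xs ! i # ys) \<longleftrightarrow> i \<in> S"
    \<comment> \<open>The witness tuple is spliced into the \<open>l\<close> quantified variables
      from \<open>n\<close> on; the points keep the variables below \<open>n\<close>.\<close>
    define w where "w i = (if i \<in> {n..<n+l} then ys ! (i - n) else xs ! i)" for i
    have map_w: "map w [n..<n+l] = ys"
      using ys(1) by (auto simp: tuples_def w_def intro!: nth_equalityI)
    have "w i = xs ! i" if "i < n" for i using that by (simp add: w_def)
    then have "\<forall>i<n. holds M p (w i # map w [n..<n+l]) \<longleftrightarrow> i \<in> S"
      using ys(2) map_w by simp
    moreover have "w ` set [n..<n+l] \<subseteq> Dom M"
      using ys(1) by (simp only: set_map[symmetric] map_w tuples_def mem_Collect_eq)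
    moreover have "\<forall>i. i \<notin> set [n..<n+l] \<longrightarrow> w i = xs ! i"
      by (simp add: w_def)
    ultimately show "\<exists>w. w ` set [n..<n+l] \<subseteq> Dom M \<and> (\<forall>i. i \<notin> set [n..<n+l] \<longrightarrow> w i = xs ! i) \<and>
      (\<forall>i<n. holds M p (w i # map w [n..<n+l]) \<longleftrightarrow> i \<in> S)"
      by blast
  qed
  finally show ?thesis .
qed

text \<open>The VC-dimension bound for \<open>p\<close> as a single formula in \<open>n\<close>
  points: some subset of the points is not cut out by any parameter tuple. Being a formula, the
  bound given by NIP in \<open>M\<close> can be listed among the conditions that compactness
  realises in another model.\<close>

definition unshattered_fm :: "('f, 'r) fm \<Rightarrow> nat \<Rightarrow> nat \<Rightarrow> ('f, 'r) fm" where
  "unshattered_fm p l n = Neg (Conjs (map (\<lambda>xs. pattern_fm p l n (set xs)) (subseqs [0..<n])))"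

lemma formula_unshattered_fm:
  "formula L (Suc l) p \<Longrightarrow> formula L n (unshattered_fm p l n)"
proof -
  assume p: "formula L (Suc l) p"
  then have "formula L n (pattern_fm p l n S)" for S
    by (rule formula_pattern_fm)
  then have "wf_fm L (pattern_fm p l n S)" "fv (pattern_fm p l n S) \<subseteq> {..<n}" for S
    by (simp_all add: formula_def)
  then show ?thesis using p
    unfolding formula_def unshattered_fm_def
    by (simp only: wf_fm.simps fv.simps Conjs_simps set_map) blast
qed

lemma holds_unshattered_fm:
  "holds M (unshattered_fm p l n) xs \<longleftrightarrow> (\<exists>S\<subseteq>{..<n}. \<not> holds M (pattern_fm p l n S) xs)"
proof -
  have "set ` set (subseqs [0..<n]) = Pow {..<n}"
    by (simp add: subseqs_powset atLeast0LessThan)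
  then have "(\<forall>S\<subseteq>{..<n}. holds M (pattern_fm p l n S) xs) \<longleftrightarrow>
     (\<forall>ys\<in>set (subseqs [0..<n]). holds M (pattern_fm p l n (set ys)) xs)"
    by (metis Pow_iff imageE imageI)
  then show ?thesis by (auto simp: unshattered_fm_def holds_def)
qed

lemma NIP_unshattered:
  fixes M :: "('f, 'r, 'a) struct"
  assumes "NIP L M" and p: "formula L (Suc l) p"
  obtains n where "\<And>xs. xs \<in> tuples M n \<Longrightarrow> holds M (unshattered_fm p l n) xs"
proof -
  let ?shattered = "\<lambda>n. \<exists>(a :: nat \<Rightarrow> 'a list) (b :: nat set \<Rightarrow> 'a list).
          (\<forall>i<n. a i \<in> tuples M 1) \<and> (\<forall>S\<subseteq>{..<n}. b S \<in> tuples M l) \<and>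
          (\<forall>i<n. \<forall>S\<subseteq>{..<n}. holds M p (a i @ b S) \<longleftrightarrow> i \<in> S)"
  have "formula L (1 + l) p" using p by simp
  then have "\<not> (\<forall>n. ?shattered n)"
    by (rule assms(1)[unfolded NIP_def, THEN spec[of _ 1], THEN spec[of _ l], THEN spec[of _ p], THEN mp])
  then obtain n where n: "\<not> ?shattered n"
    unfolding not_all ..
  have "holds M (unshattered_fm p l n) xs" if xs: "xs \<in> tuples M n" for xs
  proof (rule ccontr)
    assume "\<not> ?thesis"
    then have "\<forall>S\<in>Pow {..<n}. \<exists>ys\<in>tuples M l. \<forall>i<n. holds M p (xs ! i # ys) \<longleftrightarrow> i \<in> S"
      using holds_pattern_fm[OF p, of xs n M] xs by (auto simp: holds_unshattered_fm tuples_def)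
    from bchoice[OF this[unfolded Bex_def]] obtain b where
      b: "\<forall>S\<in>Pow {..<n}. b S \<in> tuples M l \<and> (\<forall>i<n. holds M p (xs ! i # b S) \<longleftrightarrow> i \<in> S)" ..
    have "\<forall>i<n. [xs ! i] \<in> tuples M 1" using xs by (auto simp: tuples_def)
    with b n show False
      by (elim notE, intro exI[of _ "\<lambda>i. [xs ! i]"] exI[of _ b]) simp
  qed
  then show thesis by (rule that)
qed

section \<open>Indiscernible sequences\<close>

definition homogeneous ::
  "('d \<Rightarrow> nat) \<Rightarrow> 'd set \<Rightarrow> 'a set \<Rightarrow> ('d \<Rightarrow> 'a set \<Rightarrow> bool) \<Rightarrow> bool" where
  "homogeneous ar \<Delta> H f \<longleftrightarrow>
     (\<forall>\<delta>\<in>\<Delta>. \<forall>A\<in>nsets H (ar \<delta>). \<forall>B\<in>nsets H (ar \<delta>). f \<delta> A = f \<delta> B)"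

text \<open>Homogeneity passes to subsets, so the colourings can be treated one after another: with
  \<open>R1\<close> sufficient for \<Delta>, let \<open>R2\<close> be the Ramsey number that
  guarantees \<open>R1\<close> points homogeneous for the new colouring, and thin these out by the
  induction hypothesis.\<close>

lemma finite_ramsey_family:
  fixes \<Delta> :: "'d set" and ar :: "'d \<Rightarrow> nat"
  assumes "finite \<Delta>"
  shows "\<exists>R. \<forall>V :: nat set. finite V \<and> R \<le> card V \<longrightarrow> (\<forall>f :: 'd \<Rightarrow> nat set \<Rightarrow> bool.
    \<exists>H\<subseteq>V. card H = N \<and> homogeneous ar \<Delta> H f)"
  using assms
proof induction
  case empty
  have "\<exists>H\<subseteq>V. card H = N" if "N \<le> card V" for V :: "nat set"
    using obtain_subset_with_card_n[OF that] by metis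
  then show ?case by (intro exI[of _ N]) (simp add: homogeneous_def)
next
  case (insert d \<Delta>)
  from insert.IH obtain R1 where R1': "\<forall>V :: nat set. finite V \<and> R1 \<le> card V \<longrightarrow>
    (\<forall>f. \<exists>H\<subseteq>V. card H = N \<and> homogeneous ar \<Delta> H f)" ..
  then have R1: "\<exists>H\<subseteq>V. card H = N \<and> homogeneous ar \<Delta> H f"
    if "finite V" "R1 \<le> card V" for V :: "nat set" and f
    using R1'[THEN spec[of _ V]] that by simp
  obtain R2 :: nat where R2: "partn_lst {..<R2} [R1, R1] (ar d)"
    using ramsey_full by blast
  have "\<exists>H\<subseteq>V. card H = N \<and> homogeneous ar (insert d \<Delta>) H f"
    if V: "finite V" "R2 \<le> card V" for V :: "nat set" and f :: "'d \<Rightarrow> nat set \<Rightarrow> bool"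
  proof -
    \<comment> \<open>The Ramsey number speaks about an initial segment of the naturals; the
      colouring of \<open>V\<close> is pulled back along an injection of that segment.\<close>
    obtain g where g: "inj_on g {..<R2}" "g ` {..<R2} \<subseteq> V"
      using V card_le_inj[of "{..<R2}" V] by auto
    define col where "col X = (if f d (g ` X) then 0 else 1 :: nat)" for X
    have "col \<in> nsets {..<R2} (ar d) \<rightarrow> {..<length [R1, R1]}" by (auto simp: col_def)
    then obtain i H where i: "i < length [R1, R1]" "H \<in> nsets {..<R2} ([R1, R1] ! i)"
      and col: "col ` nsets H (ar d) \<subseteq> {i}"
      by (rule partn_lstE[OF R2 _ refl])
    from i have "H \<in> nsets {..<R2} R1" by (auto simp: less_Suc_eq)
    note H = this col
    have sub: "H \<subseteq> {..<R2}" and cardH: "card H = R1" and fH: "finite H"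
      using H(1) by (auto simp: nsets_def)
    have gH: "inj_on g H" using g(1) sub by (rule inj_on_subset)
    then have "card (g ` H) = R1" using cardH by (simp add: card_image)
    then obtain H1 where H1: "H1 \<subseteq> g ` H" "card H1 = N"
      "homogeneous ar \<Delta> H1 f"
      using R1[of "g ` H" f] fH by auto
    have d: "f d A \<longleftrightarrow> i = 0" if "A \<in> nsets H1 (ar d)" for A
    proof -
      have "A \<in> nsets (g ` H) (ar d)" using that H1(1) nsets_mono by blast
      moreover have "nsets (g ` H) (ar d) = (`) g ` nsets H (ar d)"
        using bij_betw_nsets[of g H "g ` H" "ar d"] gH by (simp add: bij_betw_def)
      ultimately obtain A' where A': "A' \<in> nsets H (ar d)" "A = g ` A'"
        by (metis imageE)
      then have "col A' = i" using H(2) by blast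
      then show ?thesis using A'(2) by (auto simp: col_def split: if_splits)
    qed
    have "H1 \<subseteq> V" using H1(1) sub g(2) by blast
    moreover have "homogeneous ar (insert d \<Delta>) H1 f"
      using H1(3) d unfolding homogeneous_def by blast
    ultimately show ?thesis using H1(2) by blast
  qed
  then show ?case by (intro exI[of _ R2]) simp
qed

text \<open>Indiscernibility restricted to the formulas in \<Delta>. Each formula is paired with its
  number of arguments because a formula does not determine that number.\<close>

definition indisc_on ::
  "('f, 'r, 'a) struct \<Rightarrow> (nat \<times> ('f, 'r) fm) set \<Rightarrow> 'i::linorder set \<Rightarrow> ('i \<Rightarrow> 'a) \<Rightarrow> bool" where
  "indisc_on M \<Delta> J c \<longleftrightarrow> (\<forall>is js p.
     sorted_wrt (<) is \<and> sorted_wrt (<) js \<and> length is = length js \<and> set is \<subseteq> J \<and> set js \<subseteq> J \<and>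
     (length is, p) \<in> \<Delta> \<longrightarrow> (holds M p (map c is) \<longleftrightarrow> holds M p (map c js)))"

lemma indisc_onD:
  assumes "indisc_on M \<Delta> J c" "(length is, p) \<in> \<Delta>" "sorted_wrt (<) is" "sorted_wrt (<) js"
    "length js = length is" "set is \<subseteq> J" "set js \<subseteq> J"
  shows "holds M p (map c is) \<longleftrightarrow> holds M p (map c js)"
  by (rule assms(1)[unfolded indisc_on_def, THEN spec[of _ "is"], THEN spec[of _ js], THEN spec[of _ p], THEN mp])
    (simp add: assms(2-))

lemma indisc_onI:
  assumes "\<And>p is js. (length is, p) \<in> \<Delta> \<Longrightarrow> sorted_wrt (<) is \<Longrightarrow> sorted_wrt (<) js \<Longrightarrow>
    length js = length is \<Longrightarrow> set is \<subseteq> J \<Longrightarrow> set js \<subseteq> J \<Longrightarrow>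
    holds M p (map c is) \<longleftrightarrow> holds M p (map c js)"
  shows "indisc_on M \<Delta> J c"
  unfolding indisc_on_def by (intro allI impI, elim conjE, rule assms) simp_all

text \<open>Distality is stated for sequences of tuples. It will be applied to sequences of
  elements, read as sequences of 1-tuples.\<close>

lemma indiscernible_singletons:
  "indiscernible L M 1 J (\<lambda>i. [c i]) \<longleftrightarrow> c ` J \<subseteq> Dom M \<and> indisc_on M {(r, p). formula L r p} J c"
proof -
  have "(\<forall>i\<in>J. [c i] \<in> tuples M 1) \<longleftrightarrow> c ` J \<subseteq> Dom M"
    by (auto simp: tuples_def)
  then show ?thesis
    by (simp only: indiscernible_def indisc_on_def concat_map_singleton mult_1_right mem_Collect_eq case_prod_conv)
qed

lemma indisc_on_reindex:
  assumes "indisc_on M \<Delta> J c" "strict_mono_on K f" "f ` K \<subseteq> J"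
  shows "indisc_on M \<Delta> K (c \<circ> f)"
proof (rule indisc_onI)
  fix p "is" js
  assume a: "(length is, p) \<in> \<Delta>" "sorted_wrt (<) is" "sorted_wrt (<) js"
    "length js = length is" "set is \<subseteq> K" "set js \<subseteq> K"
  have "sorted_wrt (<) (map f xs)" if "sorted_wrt (<) xs" "set xs \<subseteq> K" for xs
    unfolding sorted_wrt_map
    by (rule sorted_wrt_mono_rel[OF _ that(1)]) (use that(2) assms(2) in \<open>auto simp: strict_mono_on_def\<close>)
  then have "holds M p (map c (map f is)) \<longleftrightarrow> holds M p (map c (map f js))"
    using a image_mono[OF a(5), of f] image_mono[OF a(6), of f] assms(3)
    by (intro indisc_onD[OF assms(1)]) auto
  then show "holds M p (map (c \<circ> f) is) \<longleftrightarrow> holds M p (map (c \<circ> f) js)" by simp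
qed

text \<open>Increasing \<open>r\<close>-tuples of indices are the same as \<open>r\<close>-element
  sets of indices, so a formula in \<open>r\<close> variables is a 2-colouring of such sets, and a
  set homogeneous for all formulas in \<Delta> indexes a \<Delta>-indiscernible subsequence. The
  bound is the same for all sequences \<open>c\<close>.\<close>

lemma ramsey_indisc:
  fixes M :: "('f, 'r, 'a) struct"
  assumes "finite \<Delta>"
  obtains R where "\<forall>c :: nat \<Rightarrow> 'a. \<exists>H\<subseteq>{..<R}. card H = N \<and> indisc_on M \<Delta> H c"
proof -
  obtain R where R': "\<forall>V :: nat set. finite V \<and> R \<le> card V \<longrightarrow>
    (\<forall>f. \<exists>H\<subseteq>V. card H = N \<and> homogeneous fst \<Delta> H f)"
    using finite_ramsey_family[OF assms, of N fst] ..
  then have R: "\<exists>H\<subseteq>{..<R}. card H = N \<and> homogeneous fst \<Delta> H f" for f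
    using R'[THEN spec[of _ "{..<R}"]] by simp
  have "\<exists>H\<subseteq>{..<R}. card H = N \<and> indisc_on M \<Delta> H c" for c :: "nat \<Rightarrow> 'a"
  proof -
    define f where "f \<delta> A = holds M (snd \<delta>) (map c (sorted_list_of_set A))" for \<delta> :: "nat \<times> ('f, 'r) fm" and A
    obtain H where H: "H \<subseteq> {..<R}" "card H = N"
      "homogeneous fst \<Delta> H f"
      using R[of f] by blast
    have "indisc_on M \<Delta> H c"
    proof (rule indisc_onI)
      fix p "is" js
      assume a: "(length is, p) \<in> \<Delta>" "sorted_wrt (<) is" "sorted_wrt (<) js"
        "length js = length is" "set is \<subseteq> H" "set js \<subseteq> H"
      have s: "sorted_list_of_set (set xs) = xs" "distinct xs" if "sorted_wrt (<) xs" for xs :: "nat list"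
        using that by (auto simp: strict_sorted_iff sorted_list_of_set.idem_if_sorted_distinct)
      have "set is \<in> nsets H (length is)" "set js \<in> nsets H (length is)"
        using a s(2) by (auto simp: nsets_def distinct_card)
      then have "f (length is, p) (set is) = f (length is, p) (set js)"
        using H(3) a(1) unfolding homogeneous_def by (metis fst_conv)
      then show "holds M p (map c is) \<longleftrightarrow> holds M p (map c js)"
        using a s(1) by (simp add: f_def)
    qed
    with H show ?thesis by blast
  qed
  then show thesis by (intro that allI)
qed

section \<open>Filling gaps by distality\<close>

lemma strict_mono_squash: "strict_mono (\<lambda>x :: rat. x / (1 + \<bar>x\<bar>))"
proof (rule strict_monoI)
  fix x y :: rat assume xy: "x < y"
  have "x * (1 + \<bar>y\<bar>) < y * (1 + \<bar>x\<bar>)"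
  proof (cases "x < 0 \<and> 0 \<le> y")
    case True
    then have "x * (1 + \<bar>y\<bar>) < 0" by (intro mult_neg_pos) auto
    also have "0 \<le> y * (1 + \<bar>x\<bar>)" using True by (intro mult_nonneg_nonneg) auto
    finally show ?thesis .
  next
    case False
    then show ?thesis using xy by (auto simp: abs_if algebra_simps)
  qed
  then show "x / (1 + \<bar>x\<bar>) < y / (1 + \<bar>y\<bar>)"
    by (simp add: frac_less_eq divide_simps add_pos_nonneg)
qed

text \<open>A copy of the rationals that passes through prescribed points and misses the rest of a
  finite set. Distinct points of \<open>A\<close> are at least \<epsilon> apart and every value of
  \<open>f\<close> lies at distance less than \<epsilon> from some entry of \<open>ts\<close>, so
  \<open>f\<close> hits no other point of \<open>A\<close>. The stretches around the entries are
  squeezed by the increasing map \<open>h\<close> into (-1, 1).\<close>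

lemma rat_embedding_through:
  fixes ts :: "rat list"
  assumes "finite A" "set ts \<subseteq> A" "sorted_wrt (<) ts" "ts \<noteq> []"
  obtains f :: "rat \<Rightarrow> rat" where "strict_mono f" "\<forall>i < length ts. f (of_nat i) = ts ! i"
    "\<forall>x. f x \<in> A \<longrightarrow> f x \<in> set ts"
proof -
  \<comment> \<open>The extra element 1 keeps \<open>D\<close> nonempty when \<open>A\<close> has a
    single point.\<close>
  define D where "D = insert 1 ((\<lambda>(a, b). \<bar>a - b\<bar>) ` {(a, b). a \<in> A \<and> b \<in> A \<and> a \<noteq> b})"
  define \<epsilon> where "\<epsilon> = Min D"
  have "finite {(a, b). a \<in> A \<and> b \<in> A \<and> a \<noteq> b}"
    by (rule finite_subset[OF _ finite_cartesian_product[OF assms(1) assms(1)]]) auto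
  then have "finite D" by (simp add: D_def)
  moreover from this have "0 < Min D"
    by (subst Min_gr_iff) (auto simp: D_def)
  ultimately have \<epsilon>: "0 < \<epsilon>" "\<And>a b. a \<in> A \<Longrightarrow> b \<in> A \<Longrightarrow> a \<noteq> b \<Longrightarrow> \<epsilon> \<le> \<bar>a - b\<bar>"
    unfolding \<epsilon>_def by (auto simp: D_def intro!: Min_le)
  define h :: "rat \<Rightarrow> rat" where "h x = x / (1 + \<bar>x\<bar>)" for x
  have h: "strict_mono h" using strict_mono_squash by (simp add: h_def[abs_def])
  have pos: "0 < 1 + \<bar>x\<bar>" for x :: rat by (rule add_pos_nonneg) simp_all
  have h1: "\<bar>h x\<bar> < 1" for x
    unfolding h_def abs_divide abs_of_pos[OF pos] by (subst divide_less_eq_1_pos[OF pos]) simp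
  have h0: "0 \<le> x \<Longrightarrow> 0 \<le> h x" for x
    unfolding h_def by (intro divide_nonneg_pos pos)
  \<comment> \<open>The entry near which \<open>f x\<close> is placed. Arguments below 0 go to the
    first entry, arguments beyond the last index to the last entry.\<close>
  define idx where "idx x = nat (min \<lfloor>x\<rfloor> (int (length ts) - 1))" for x :: rat
  define f where "f x = ts ! idx x + \<epsilon> * h (x - of_nat (idx x))" for x
  have len: "0 < length ts" using assms(4) by simp
  have idx_less: "idx x < length ts" for x
    unfolding idx_def using len by linarith
  have idx_mono: "x \<le> y \<Longrightarrow> idx x \<le> idx y" for x y
    unfolding idx_def by (intro nat_mono min.mono floor_mono) auto
  have idx_le: "of_nat (idx x) \<le> x" if "0 < idx x" for x
  proof -
    have "int (idx x) \<le> \<lfloor>x\<rfloor>" using that by (auto simp: idx_def)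
    then have "(of_int (int (idx x)) :: rat) \<le> x" by (simp only: le_floor_iff)
    then show ?thesis by simp
  qed
  have close: "\<bar>f x - ts ! idx x\<bar> < \<epsilon>" for x
    using h1[of "x - of_nat (idx x)"] \<epsilon>(1) by (simp add: f_def abs_mult)
  have "strict_mono f"
  proof (rule strict_monoI)
    fix x y :: rat assume xy: "x < y"
    show "f x < f y"
    proof (cases "idx x = idx y")
      case True
      then show ?thesis using xy \<epsilon>(1) strict_monoD[OF h] by (simp add: f_def)
    next
      case False
      then have lt: "idx x < idx y" using idx_mono[of x y] xy by simp
      then have l: "ts ! idx x < ts ! idx y"
        using assms(3) idx_less by (simp add: sorted_wrt_nth_less)
      moreover have "ts ! idx x \<in> A" "ts ! idx y \<in> A" using idx_less assms(2) by auto
      ultimately have "\<epsilon> \<le> ts ! idx y - ts ! idx x" using \<epsilon>(2)[of "ts ! idx x" "ts ! idx y"] by auto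
      moreover have "f x < ts ! idx x + \<epsilon>" using close[of x] by linarith
      moreover have "ts ! idx y \<le> f y"
        using idx_le[of y] lt h0[of "y - of_nat (idx y)"] \<epsilon>(1) by (simp add: f_def)
      ultimately show ?thesis by linarith
    qed
  qed
  moreover have "f (of_nat i) = ts ! i" if "i < length ts" for i
  proof -
    have "idx (of_nat i) = i" using that by (auto simp: idx_def)
    then show ?thesis by (simp add: f_def h_def)
  qed
  moreover have "f x \<in> set ts" if "f x \<in> A" for x
  proof -
    have "ts ! idx x \<in> A" using idx_less assms(2) by auto
    then have "f x = ts ! idx x" using \<epsilon>(2)[OF that] close[of x] by fastforce
    then show ?thesis using idx_less by simp
  qed
  ultimately show thesis by (intro that allI impI) simp_all
qed

text \<open>The definition of distality puts the two cuts at 0 and 1. The increasing affine map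
  \<open>f\<close> carries these to \<open>p\<close> and \<open>q\<close>, and its inverse
  \<open>g\<close> brings the conclusion back.\<close>

lemma distal_two_points:
  fixes L :: "('f, 'r) lang" and M :: "('f, 'r, 'a) struct"
    and N :: "('f, 'r, ('f, 'r, 'a) univ) struct" and c :: "rat \<Rightarrow> ('f, 'r, 'a) univ"
  assumes dist: "distal L M" and N: "wf_struct L N" "elem_equiv L M N"
    and c: "range c \<subseteq> Dom N" and "p < q"
    and p: "indisc_on N {(r, p). formula L r p} (- {p}) c"
    and q: "indisc_on N {(r, p). formula L r p} (- {q}) c"
  shows "indisc_on N {(r, p). formula L r p} UNIV c"
proof -
  define f where "f x = p + (q - p) * x" for x
  have f: "strict_mono f" using \<open>p < q\<close> by (auto simp: f_def intro!: strict_monoI)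
  have f01: "f 0 = p" "f 1 = q" by (auto simp: f_def)
  have "indisc_on N {(r, p). formula L r p} (- {1}) (c \<circ> f)"
    using f f01 injD[OF strict_mono_imp_inj_on[OF f]]
    by (intro indisc_on_reindex[OF q]) (auto simp: strict_mono_on_def strict_mono_less)
  moreover have "indisc_on N {(r, p). formula L r p} (- {0}) (c \<circ> f)"
    using f f01 injD[OF strict_mono_imp_inj_on[OF f]]
    by (intro indisc_on_reindex[OF p]) (auto simp: strict_mono_on_def strict_mono_less)
  ultimately have "indiscernible L N 1 (- {1}) (\<lambda>i. [(c \<circ> f) i]) \<and> indiscernible L N 1 (- {0}) (\<lambda>i. [(c \<circ> f) i])"
    using c by (auto simp only: indiscernible_singletons) auto
  then have "indiscernible L N 1 UNIV (\<lambda>i. [(c \<circ> f) i])"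
    using dist N unfolding distal_def by blast
  then have *: "indisc_on N {(r, p). formula L r p} UNIV (c \<circ> f)"
    by (simp only: indiscernible_singletons)
  define g where "g y = (y - p) / (q - p)" for y
  have "strict_mono g" using \<open>p < q\<close> by (auto simp: g_def intro!: strict_monoI divide_strict_right_mono)
  then have "indisc_on N {(r, p). formula L r p} UNIV ((c \<circ> f) \<circ> g)"
    by (intro indisc_on_reindex[OF *]) (auto simp: strict_mono_less strict_mono_on_def)
  moreover have "f (g y) = y" for y using \<open>p < q\<close> by (simp add: f_def g_def)
  then have "(c \<circ> f) \<circ> g = c" by auto
  ultimately show ?thesis by simp
qed

text \<open>An instance of indiscernibility involves finitely many indices. Take a copy of the
  rationals through these, \<open>a\<close> and \<open>b\<close> that avoids \<open>E\<close>: along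
  it each hypothesis leaves out one point only, which is the situation of
  \<open>distal_two_points\<close>.\<close>

lemma distal_insert_two:
  fixes L :: "('f, 'r) lang" and M :: "('f, 'r, 'a) struct"
    and N :: "('f, 'r, ('f, 'r, 'a) univ) struct" and c :: "rat \<Rightarrow> ('f, 'r, 'a) univ"
  assumes dist: "distal L M" and N: "wf_struct L N" "elem_equiv L M N"
    and c: "range c \<subseteq> Dom N" and E: "finite E" and "a < b" "a \<notin> E" "b \<notin> E"
    and a: "indisc_on N {(r, p). formula L r p} (- insert a E) c"
    and b: "indisc_on N {(r, p). formula L r p} (- insert b E) c"
  shows "indisc_on N {(r, p). formula L r p} (- E) c"
proof (rule indisc_onI)
  fix p "is" js
  assume ij: "(length is, p) \<in> {(r, p). formula L r p}" "sorted_wrt (<) is" "sorted_wrt (<) js"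
    "length js = length is" "set is \<subseteq> - E" "set js \<subseteq> - E"
  define T where "T = set is \<union> set js \<union> {a, b}"
  define ts where "ts = sorted_list_of_set T"
  have T: "finite T" "T \<inter> E = {}" using ij \<open>a \<notin> E\<close> \<open>b \<notin> E\<close> by (auto simp: T_def)
  have ts: "set ts = T" "sorted_wrt (<) ts" using T(1) by (auto simp: ts_def)
  have ne: "ts \<noteq> []" using ts(1) by (auto simp: T_def)
  have fin: "finite (T \<union> E)" "set ts \<subseteq> T \<union> E" using T(1) E ts(1) by auto
  obtain f :: "rat \<Rightarrow> rat" where f: "strict_mono f" "\<forall>i < length ts. f (of_nat i) = ts ! i"
    "\<forall>x. f x \<in> T \<union> E \<longrightarrow> f x \<in> set ts"
    by (rule rat_embedding_through[OF fin ts(2) ne])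
  have surj: "T \<subseteq> range f"
  proof
    fix t assume "t \<in> T"
    then obtain i where "i < length ts" "ts ! i = t" using ts(1) by (metis in_set_conv_nth)
    then show "t \<in> range f" using f(2) by (metis rangeI)
  qed
  have range: "f x \<notin> E" for x using f(3)[rule_format, of x] ts(1) T(2) by auto
  obtain a' b' where ab: "f a' = a" "f b' = b" using surj by (auto simp: T_def)
  then have "a' < b'" using \<open>a < b\<close> strict_mono_less[OF f(1)] by metis
  moreover have "indisc_on N {(r, p). formula L r p} (- {x}) (c \<circ> f)"
    if "indisc_on N {(r, p). formula L r p} (- insert (f x) E) c" for x
    using f(1) range injD[OF strict_mono_imp_inj_on[OF f(1)]]
    by (intro indisc_on_reindex[OF that]) (auto simp: strict_mono_on_def strict_mono_less)
  ultimately have cf: "indisc_on N {(r, p). formula L r p} UNIV (c \<circ> f)"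
    using a b ab c by (intro distal_two_points[OF dist N, of "c \<circ> f" a' b']) auto
  have pre: "\<exists>xs'. xs = map f xs' \<and> sorted_wrt (<) xs'" if "set xs \<subseteq> T" "sorted_wrt (<) xs" for xs
  proof -
    have eq: "xs = map f (map (inv_into UNIV f) xs)"
      using that(1) surj by (auto simp: f_inv_into_f intro!: map_idI[symmetric])
    have "sorted_wrt (<) (map f (map (inv_into UNIV f) xs))" using that(2) eq by simp
    then have "sorted_wrt (<) (map (inv_into UNIV f) xs)"
      unfolding sorted_wrt_map[of _ f] using strict_mono_less[OF f(1)] by simp
    with eq show ?thesis by blast
  qed
  obtain is' js' where s: "is = map f is'" "sorted_wrt (<) is'" "js = map f js'" "sorted_wrt (<) js'"
    using pre[of "is"] pre[of js] ij by (auto simp: T_def)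
  have "holds N p (map (c \<circ> f) is') \<longleftrightarrow> holds N p (map (c \<circ> f) js')"
    using s ij by (intro indisc_onD[OF cf]) auto
  then show "holds N p (map c is) \<longleftrightarrow> holds N p (map c js)" by (simp add: s)
qed

text \<open>Induction on the number of gaps filled. If \<open>F\<close> contains
  \<open>a < b\<close>, the sequences with \<open>F - {a}\<close> and with \<open>F - {b}\<close>
  filled are indiscernible by induction, and \<open>distal_insert_two\<close> merges them. With at
  most one gap in \<open>F\<close> the hypothesis \<open>one\<close> applies directly.\<close>

theorem distal_insert_all:
  fixes L :: "('f, 'r) lang" and M :: "('f, 'r, 'a) struct"
    and N :: "('f, 'r, ('f, 'r, 'a) univ) struct" and c :: "rat \<Rightarrow> ('f, 'r, 'a) univ"
  assumes dist: "distal L M" and N: "wf_struct L N" "elem_equiv L M N"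
    and c: "range c \<subseteq> Dom N" and E: "finite E"
    and one: "\<And>m. indisc_on N {(r, p). formula L r p} (insert m (- E)) c"
  shows "indisc_on N {(r, p). formula L r p} UNIV c"
proof -
  have "indisc_on N {(r, p). formula L r p} (F \<union> - E) c" if "finite F" "F \<subseteq> E" for F
    using that
  proof (induction "card F" arbitrary: F rule: less_induct)
    case less
    show ?case
    proof (cases "\<exists>a\<in>F. \<exists>b\<in>F. a < b")
      case True
      then obtain a b where ab: "a \<in> F" "b \<in> F" "a < b" by blast
      \<comment> \<open>The gaps in \<open>E - F\<close> remain open; they are the set to be avoided
        in \<open>distal_insert_two\<close>.\<close>
      have ind: "indisc_on N {(r, p). formula L r p} (- insert x (E - F)) c" if "x \<in> F" for x
      proof -
        have "indisc_on N {(r, p). formula L r p} ((F - {x}) \<union> - E) c"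
          using less.prems card_Diff1_less[OF less.prems(1) that] by (intro less.hyps) auto
        moreover have "(F - {x}) \<union> - E = - insert x (E - F)" using that less.prems by auto
        ultimately show ?thesis by simp
      qed
      have "indisc_on N {(r, p). formula L r p} (- (E - F)) c"
        using ab E ind by (intro distal_insert_two[OF dist N c, of "E - F" a b]) auto
      moreover have "- (E - F) = F \<union> - E" by auto
      ultimately show ?thesis by simp
    next
      case False
      then obtain m where "F \<subseteq> {m}" by (metis all_not_in_conv empty_subsetI linorder_neqE_linordered_idom singletonI subsetI singletonD)
      then have "F \<union> - E \<subseteq> insert m (- E)" by auto
      then have "indisc_on N {(r, p). formula L r p} (F \<union> - E) (c \<circ> id)"
        by (intro indisc_on_reindex[OF one[of m]]) (auto simp: strict_mono_on_def)
      then show ?thesis by simp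
    qed
  qed
  from this[OF E order_refl] show ?thesis by (simp add: Compl_partition)
qed

section \<open>Counting\<close>

lemma has_at_least_iff: "has_at_least S n \<longleftrightarrow> (\<exists>f :: nat \<Rightarrow> 'a. inj_on f {..<n} \<and> f ` {..<n} \<subseteq> S)"
proof
  assume "has_at_least S n"
  then obtain X where X: "X \<subseteq> S" "card X = n" "finite X"
    unfolding has_at_least_def
    by (metis infinite_arbitrarily_large obtain_subset_with_card_n)
  then obtain f where "bij_betw f {0..<n} X" using ex_bij_betw_nat_finite[of X] by auto
  then show "\<exists>f. inj_on f {..<n} \<and> f ` {..<n} \<subseteq> S"
    using X by (intro exI[of _ f]) (auto simp: bij_betw_def atLeast0LessThan)
next
  assume "\<exists>f :: nat \<Rightarrow> 'a. inj_on f {..<n} \<and> f ` {..<n} \<subseteq> S"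
  then show "has_at_least S n"
    unfolding has_at_least_def by (metis card_image card_lessThan card_mono)
qed

lemma has_at_least_mono: "has_at_least S n \<Longrightarrow> m \<le> n \<Longrightarrow> has_at_least S m"
  by (auto simp: has_at_least_def)

text \<open>The union bound: the sets \<open>X i\<close> together have at most
  \<open>card I * K\<close> elements.\<close>

lemma has_at_least_diff_UN:
  assumes B: "has_at_least B (Suc (card I * K))" and I: "finite I"
    and X: "\<And>i. i \<in> I \<Longrightarrow> \<not> has_at_least (X i) K"
  shows "\<exists>b\<in>B. \<forall>i\<in>I. b \<notin> X i"
proof -
  have fin: "finite (\<Union>i\<in>I. X i)" using I X by (auto simp: has_at_least_def)
  have "card (\<Union>i\<in>I. X i) \<le> (\<Sum>i\<in>I. card (X i))" by (rule card_UN_le[OF I])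
  also have "\<dots> \<le> (\<Sum>i\<in>I. K)" using X by (intro sum_mono) (fastforce simp: has_at_least_def)
  finally have "card (\<Union>i\<in>I. X i) \<le> card I * K" by simp
  then have "\<not> B \<subseteq> (\<Union>i\<in>I. X i)"
    using B fin card_mono[OF fin, of B] finite_subset[OF _ fin, of B] by (auto simp: has_at_least_def)
  then show ?thesis by blast
qed

lemma indisc_on_cong:
  "(\<And>i. i \<in> J \<Longrightarrow> c i = c' i) \<Longrightarrow> indisc_on M \<Delta> J c \<longleftrightarrow> indisc_on M \<Delta> J c'"
proof -
  assume eq: "\<And>i. i \<in> J \<Longrightarrow> c i = c' i"
  have *: "map c xs = map c' xs" if "set xs \<subseteq> J" for xs
    using that eq by (auto intro!: map_cong)
  show ?thesis
    unfolding indisc_on_def by (intro all_cong1 imp_cong refl; elim conjE; simp only: *)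
qed

lemma indisc_on_subset:
  assumes "indisc_on M \<Delta> J c" "K \<subseteq> J"
  shows "indisc_on M \<Delta> K c"
  using indisc_on_reindex[OF assms(1), of K id] assms(2) by (simp add: strict_mono_on_def)

section \<open>Indiscernibility as a set of formulas\<close>

definition conj_set :: "('f, 'r) fm set \<Rightarrow> ('f, 'r) fm" where
  "conj_set A = Conjs (SOME ps. set ps = A)"

lemma conj_set_simps [simp]:
  assumes "finite A"
  shows "sat M v (conj_set A) \<longleftrightarrow> (\<forall>p\<in>A. sat M v p)"
    "wf_fm L (conj_set A) \<longleftrightarrow> (\<forall>p\<in>A. wf_fm L p)"
    "fv (conj_set A) = (\<Union>p\<in>A. fv p)"
  using someI_ex[OF finite_list[OF assms]] by (simp_all add: conj_set_def)

text \<open>The variable \<open>enc i\<close> stands for the element with index \<open>i\<close>.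
  For finite \<Delta> and \<open>J\<close> the set is finite and its conjunction is used to define
  the gap sets; for infinite ones it serves as a set of conditions for compactness.\<close>

definition indisc_fms ::
  "('i::linorder \<Rightarrow> nat) \<Rightarrow> (nat \<times> ('f, 'r) fm) set \<Rightarrow> 'i set \<Rightarrow> ('f, 'r) fm set" where
  "indisc_fms enc \<Delta> J = {Iff (inst p (map enc is)) (inst p (map enc js)) | is js p.
     sorted_wrt (<) is \<and> sorted_wrt (<) js \<and> length is = length js \<and> set is \<subseteq> J \<and> set js \<subseteq> J \<and>
     (length is, p) \<in> \<Delta>}"

lemma distinct_map_enc:
  "sorted_wrt (<) (is :: 'i::linorder list) \<Longrightarrow> set is \<subseteq> J \<Longrightarrow> inj_on enc J \<Longrightarrow> distinct (map enc is)"
  by (auto simp: strict_sorted_iff distinct_map intro: inj_on_subset)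

lemma sat_indisc_fms:
  assumes \<Delta>: "\<Delta> \<subseteq> {(r, p). formula L r p}" and inj: "inj_on enc J"
  shows "(\<forall>q\<in>indisc_fms enc \<Delta> J. sat M v q) \<longleftrightarrow> indisc_on M \<Delta> J (v \<circ> enc)"
proof -
  have *: "sat M v (inst p (map enc xs)) \<longleftrightarrow> holds M p (map (v \<circ> enc) xs)"
    if "sorted_wrt (<) xs" "set xs \<subseteq> J" "(length xs, p) \<in> \<Delta>" for xs p
    using sat_inst[of L "map enc xs" p M v] distinct_map_enc[OF that(1,2) inj] \<Delta> that(3) by auto
  have "(\<forall>q\<in>indisc_fms enc \<Delta> J. sat M v q) \<longleftrightarrow> (\<forall>is js p.
     sorted_wrt (<) is \<and> sorted_wrt (<) js \<and> length is = length js \<and> set is \<subseteq> J \<and> set js \<subseteq> J \<and>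
     (length is, p) \<in> \<Delta> \<longrightarrow> sat M v (Iff (inst p (map enc is)) (inst p (map enc js))))"
    unfolding indisc_fms_def by blast
  also have "\<dots> \<longleftrightarrow> indisc_on M \<Delta> J (v \<circ> enc)"
    unfolding indisc_on_def Iff_simps by (intro all_cong1 imp_cong refl; elim conjE; simp add: *)
  finally show ?thesis .
qed

lemma wf_indisc_fms:
  "\<Delta> \<subseteq> {(r, p). formula L r p} \<Longrightarrow> q \<in> indisc_fms enc \<Delta> J \<Longrightarrow> wf_fm L q"
  by (auto simp: indisc_fms_def formula_def)

lemma fv_indisc_fms:
  assumes \<Delta>: "\<Delta> \<subseteq> {(r, p). formula L r p}" and inj: "inj_on enc J" and q: "q \<in> indisc_fms enc \<Delta> J"
  shows "fv q \<subseteq> enc ` J"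
proof -
  have "fv (inst p (map enc xs)) \<subseteq> enc ` J"
    if "sorted_wrt (<) xs" "set xs \<subseteq> J" "(length xs, p) \<in> \<Delta>" for xs p
    using fv_inst[of L "map enc xs" p] distinct_map_enc[OF that(1,2) inj] \<Delta> that(2,3) by fastforce
  moreover from q obtain "is" js p where eq: "q = Iff (inst p (map enc is)) (inst p (map enc js))"
      and c: "sorted_wrt (<) is" "sorted_wrt (<) js" "length is = length js" "set is \<subseteq> J" "set js \<subseteq> J"
        "(length is, p) \<in> \<Delta>"
      unfolding indisc_fms_def mem_Collect_eq by (elim exE conjE)
  ultimately show ?thesis by (simp add: eq)
qed

lemma finite_indisc_fms:
  assumes "finite \<Delta>" "finite J"
  shows "finite (indisc_fms enc \<Delta> J)"
proof (rule finite_subset)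
  let ?X = "{xs. set xs \<subseteq> J \<and> distinct xs}"
  show "indisc_fms enc \<Delta> J \<subseteq> (\<lambda>(is, js, p). Iff (inst p (map enc is)) (inst p (map enc js))) `
     (?X \<times> ?X \<times> snd ` \<Delta>)"
  proof
    fix q assume "q \<in> indisc_fms enc \<Delta> J"
    then obtain "is" js p where eq: "q = Iff (inst p (map enc is)) (inst p (map enc js))"
      and c: "sorted_wrt (<) is" "sorted_wrt (<) js" "length is = length js" "set is \<subseteq> J" "set js \<subseteq> J"
        "(length is, p) \<in> \<Delta>"
      unfolding indisc_fms_def mem_Collect_eq by (elim exE conjE)
    from c(6) have "p \<in> snd ` \<Delta>" by force
    with c have "(is, js, p) \<in> ?X \<times> ?X \<times> snd ` \<Delta>" by (simp add: strict_sorted_iff)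
    then show "q \<in> (\<lambda>(is, js, p). Iff (inst p (map enc is)) (inst p (map enc js))) ` (?X \<times> ?X \<times> snd ` \<Delta>)"
      unfolding eq by (rule rev_image_eqI) simp
  qed
  show "finite ((\<lambda>(is, js, p). Iff (inst p (map enc is)) (inst p (map enc js))) ` (?X \<times> ?X \<times> snd ` \<Delta>))"
    using assms finite_subset_distinct[OF assms(2)] by (intro finite_imageI finite_cartesian_product)
qed

lemma indisc_fms_mono:
  "\<Delta> \<subseteq> \<Delta>' \<Longrightarrow> J \<subseteq> J' \<Longrightarrow> indisc_fms enc \<Delta> J \<subseteq> indisc_fms enc \<Delta>' J'"
  unfolding indisc_fms_def by blast

section \<open>Rectangles in a bipartite graph\<close>

text \<open>The argument concerns a definable relation between two elements; the group product
  enters later, through \<open>prod_fm\<close>.\<close>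

locale bipartite =
  fixes L :: "('f, 'r) lang" and M :: "('f, 'r, 'a) struct"
    and k :: nat and e :: "('f, 'r) fm" and d :: "'a list"
  assumes wf: "wf_struct L M" and e: "formula L (Suc (Suc k)) e" and d: "d \<in> tuples M k"
begin

text \<open>\<open>y\<close> takes variable 0 because the points to be shattered are the values of
  \<open>y\<close>, with \<open>x # d\<close> as parameter tuple; \<open>pattern_fm\<close> expects
  the point first.\<close>

definition edge :: "'a \<Rightarrow> 'a \<Rightarrow> bool" where
  "edge x y \<longleftrightarrow> holds M e (y # x # d)"

definition finite_rectangles :: bool where
  "finite_rectangles \<longleftrightarrow> (\<forall>n. \<exists>B C. B \<subseteq> Dom M \<and> C \<subseteq> Dom M \<and> has_at_least B n \<and> has_at_least C n \<and>
     (\<forall>x\<in>B. \<forall>y\<in>C. edge x y))"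

definition definable_rectangles :: "nat \<Rightarrow> ('f, 'r) fm \<Rightarrow> ('f, 'r) fm \<Rightarrow> bool" where
  "definable_rectangles l \<theta>\<^sub>1 \<theta>\<^sub>2 \<longleftrightarrow> (\<forall>n. \<exists>c\<in>tuples M l.
     has_at_least (defset M \<theta>\<^sub>1 c) n \<and> has_at_least (defset M \<theta>\<^sub>2 c) n \<and>
     (\<forall>x\<in>defset M \<theta>\<^sub>1 c. \<forall>y\<in>defset M \<theta>\<^sub>2 c. edge x y))"

text \<open>\<open>gap_fm\<close> defines the elements filling the gap \<open>m\<close> of a sequence indexed by \<open>T\<close>
  without destroying \<open>\<Delta>\<close>-indiscernibility, \<open>common_nbr_fm\<close> their common neighbours. Variable
  \<open>0\<close> is the free one, the next \<open>k\<close> stand for \<open>d\<close>, the following ones for the sequence.\<close>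

definition gap_enc :: "('i \<Rightarrow> nat) \<Rightarrow> 'i set \<Rightarrow> nat \<Rightarrow> 'i \<Rightarrow> nat" where
  "gap_enc pos T z q = (if q \<in> T then Suc (k + pos q) else z)"

definition gap_fm where
  "gap_fm pos T \<Delta> m z = conj_set (indisc_fms (gap_enc pos T z) \<Delta> (insert m T))"

definition common_nbr_fm where
  "common_nbr_fm pos T \<Delta> m = (let z = Suc (k + card T) in
     Neg (Exists z (Conj (gap_fm pos T \<Delta> m z) (Neg (inst e (z # 0 # [1..<Suc k]))))))"

context
  fixes T :: "rat set" and pos :: "rat \<Rightarrow> nat" and \<Delta> :: "(nat \<times> ('f, 'r) fm) set"
  assumes T: "finite T" and pos: "bij_betw pos T {..<card T}"
    and \<Delta>: "finite \<Delta>" "\<Delta> \<subseteq> {(r, p). formula L r p}"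
begin

lemma pos_less: "q \<in> T \<Longrightarrow> pos q < card T"
  using pos by (auto simp: bij_betw_def)

text \<open>The element filling the gap is variable 0 when the gap set itself is defined. In
  \<open>common_nbr_fm\<close> variable 0 is the neighbour, and the filling element is quantified as
  the first variable beyond the parameters.\<close>

lemma inj_gap_enc:
  assumes "m \<notin> T" "z = 0 \<or> z = Suc (k + card T)"
  shows "inj_on (gap_enc pos T z) (insert m T)"
proof -
  have "inj_on pos T" using pos by (simp add: bij_betw_def)
  then have "inj_on (gap_enc pos T z) T"
    by (auto simp: inj_on_def gap_enc_def)
  moreover have "gap_enc pos T z q \<noteq> gap_enc pos T z m" if "q \<in> T" for q
    using assms that pos_less[OF that] by (auto simp: gap_enc_def)
  ultimately show ?thesis by (metis Diff_iff imageE inj_on_insert)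
qed

lemma gap_fm_formula:
  assumes "m \<notin> T" "z = 0 \<or> z = Suc (k + card T)"
  shows "wf_fm L (gap_fm pos T \<Delta> m z)" "fv (gap_fm pos T \<Delta> m z) \<subseteq> insert z {..<Suc (k + card T)}"
proof -
  have fin: "finite (indisc_fms (gap_enc pos T z) \<Delta> (insert m T))"
    using T \<Delta>(1) by (simp add: finite_indisc_fms)
  show "wf_fm L (gap_fm pos T \<Delta> m z)"
    unfolding gap_fm_def conj_set_simps(2)[OF fin] using wf_indisc_fms[OF \<Delta>(2)] by blast
  have "gap_enc pos T z ` insert m T \<subseteq> insert z {..<Suc (k + card T)}"
    using pos_less by (auto simp: gap_enc_def)
  then show "fv (gap_fm pos T \<Delta> m z) \<subseteq> insert z {..<Suc (k + card T)}"
    unfolding gap_fm_def conj_set_simps(3)[OF fin]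
    using fv_indisc_fms[OF \<Delta>(2) inj_gap_enc[OF assms]] by blast
qed

lemma sat_gap_fm:
  assumes "m \<notin> T" "z = 0 \<or> z = Suc (k + card T)" "\<And>q. q \<in> T \<Longrightarrow> v (Suc (k + pos q)) = c q"
  shows "sat M v (gap_fm pos T \<Delta> m z) \<longleftrightarrow> indisc_on M \<Delta> (insert m T) (c(m := v z))"
proof -
  have fin: "finite (indisc_fms (gap_enc pos T z) \<Delta> (insert m T))"
    using T \<Delta>(1) by (simp add: finite_indisc_fms)
  have "sat M v (gap_fm pos T \<Delta> m z) \<longleftrightarrow> indisc_on M \<Delta> (insert m T) (v \<circ> gap_enc pos T z)"
    unfolding gap_fm_def conj_set_simps(1)[OF fin] by (rule sat_indisc_fms[OF \<Delta>(2) inj_gap_enc[OF assms(1,2)]])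
  also have "\<dots> \<longleftrightarrow> indisc_on M \<Delta> (insert m T) (c(m := v z))"
    using assms by (intro indisc_on_cong) (auto simp: gap_enc_def)
  finally show ?thesis .
qed

lemma formula_gap_fm: "m \<notin> T \<Longrightarrow> formula L (Suc (k + card T)) (gap_fm pos T \<Delta> m 0)"
  using gap_fm_formula[of m 0] by (auto simp: formula_def)

lemma formula_common_nbr_fm:
  assumes "m \<notin> T" shows "formula L (Suc (k + card T)) (common_nbr_fm pos T \<Delta> m)"
proof -
  have "fv (inst e (Suc (k + card T) # 0 # [1..<Suc k])) \<subseteq> set (Suc (k + card T) # 0 # [1..<Suc k])"
    using e by (intro fv_inst[of L]) (simp_all del: upt_Suc)
  then show ?thesis
    using gap_fm_formula[OF assms, of "Suc (k + card T)"] e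
    by (auto simp: formula_def common_nbr_fm_def Let_def)
qed

lemma nth_params:
  assumes "q \<in> T"
  shows "(x # d @ map (\<lambda>i. c (inv_into T pos i)) [0..<card T]) ! Suc (k + pos q) = c q"
  using assms d pos pos_less[OF assms] by (simp add: nth_append tuples_def bij_betw_def inv_into_f_f)

text \<open>The parameter tuple is the same as for \<open>common_nbr_fm\<close>, so that the two
  formulas form one family of rectangles.\<close>

lemma gap_defset:
  assumes "m \<notin> T"
  shows "defset M (gap_fm pos T \<Delta> m 0) (d @ map (\<lambda>i. c (inv_into T pos i)) [0..<card T]) =
    {y \<in> Dom M. indisc_on M \<Delta> (insert m T) (c(m := y))}"
  unfolding defset_def holds_def
  by (intro Collect_cong conj_cong refl, subst sat_gap_fm[OF assms]) (simp_all only: nth_params nth_Cons_0 simp_thms)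

lemma common_nbr_defset:
  assumes "m \<notin> T"
  shows "defset M (common_nbr_fm pos T \<Delta> m) (d @ map (\<lambda>i. c (inv_into T pos i)) [0..<card T]) =
    {x \<in> Dom M. \<forall>y\<in>Dom M. indisc_on M \<Delta> (insert m T) (c(m := y)) \<longrightarrow> edge x y}"
  unfolding defset_def
proof (intro Collect_cong conj_cong refl)
  fix x
  let ?z = "Suc (k + card T)"
  let ?ps = "d @ map (\<lambda>i. c (inv_into T pos i)) [0..<card T]"
  let ?v = "\<lambda>y. (\<lambda>i. (x # ?ps) ! i)(?z := y)"
  have gap: "sat M (?v y) (gap_fm pos T \<Delta> m ?z) \<longleftrightarrow> indisc_on M \<Delta> (insert m T) (c(m := y))" for y
  proof (subst sat_gap_fm[OF assms, where c = c])
    fix q assume q: "q \<in> T"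
    then have "Suc (k + pos q) \<noteq> ?z" using pos_less[OF q] by simp
    then show "?v y (Suc (k + pos q)) = c q"
      by (simp only: fun_upd_apply if_False nth_params[OF q])
  qed (simp_all only: fun_upd_same simp_thms)
  have "map (?v y) [1..<Suc k] = d" for y
    using d by (intro nth_equalityI) (auto simp: tuples_def nth_append simp del: upt_Suc)
  then have "sat M (?v y) (inst e (?z # 0 # [1..<Suc k])) \<longleftrightarrow> edge x y" for y
    using sat_inst[of L "?z # 0 # [1..<Suc k]" e M "?v y"] e
    by (simp add: edge_def del: upt_Suc)
  with gap show "holds M (common_nbr_fm pos T \<Delta> m) (x # ?ps) \<longleftrightarrow>
     (\<forall>y\<in>Dom M. indisc_on M \<Delta> (insert m T) (c(m := y)) \<longrightarrow> edge x y)"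
    unfolding holds_def common_nbr_fm_def Let_def sat.simps by blast
qed

end

end

section \<open>Finite approximations and the passage to the limit\<close>

context bipartite begin

text \<open>The finite part of the compactness argument, with kept indices \<open>T\<close> and gaps
  \<open>S\<close>. For each gap, \<open>thin\<close> bounds the rectangles formed by a gap set and
  its common neighbours. Indiscernibility of the filled sequence is obtained for one gap at a time;
  filling them together is left to distality.\<close>

lemma finite_approximation:
  assumes rich: finite_rectangles
    and thin: "\<And>l \<theta>\<^sub>1 \<theta>\<^sub>2. formula L (Suc l) \<theta>\<^sub>1 \<Longrightarrow> formula L (Suc l) \<theta>\<^sub>2 \<Longrightarrow> \<not> definable_rectangles l \<theta>\<^sub>1 \<theta>\<^sub>2"
    and T: "finite T" and S: "finite S" and TS: "T \<inter> S = {}"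
    and \<Delta>: "finite \<Delta>" "\<Delta> \<subseteq> {(r, p). formula L r p}"
  obtains b and c :: "rat \<Rightarrow> 'a" where "b \<in> Dom M" "range c \<subseteq> Dom M"
    "\<forall>m\<in>S. indisc_on M \<Delta> (insert m T) c" "\<forall>q\<in>T. edge b (c q)" "\<forall>m\<in>S. \<not> edge b (c m)"
proof -
  obtain pos where pos: "bij_betw pos T {..<card T}"
    using ex_bij_betw_finite_nat[OF T] by (auto simp: atLeast0LessThan)
  define \<theta>\<^sub>1 \<theta>\<^sub>2 where "\<theta>\<^sub>1 m = common_nbr_fm pos T \<Delta> m" and "\<theta>\<^sub>2 m = gap_fm pos T \<Delta> m 0" for m
  define l where "l = k + card T"
  have mT: "m \<notin> T" if "m \<in> S" for m using that TS by auto
  have "\<exists>K. \<forall>c\<in>tuples M l. has_at_least (defset M (\<theta>\<^sub>1 m) c) K \<longrightarrow> has_at_least (defset M (\<theta>\<^sub>2 m) c) K \<longrightarrow>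
     \<not> (\<forall>x\<in>defset M (\<theta>\<^sub>1 m) c. \<forall>y\<in>defset M (\<theta>\<^sub>2 m) c. edge x y)" if "m \<in> S" for m
    using thin[of l "\<theta>\<^sub>1 m" "\<theta>\<^sub>2 m"] formula_common_nbr_fm[OF T pos \<Delta> mT[OF that]]
      formula_gap_fm[OF T pos \<Delta> mT[OF that]]
    unfolding definable_rectangles_def \<theta>\<^sub>1_def \<theta>\<^sub>2_def l_def by blast
  then obtain Kf where Kf: "\<And>m c. m \<in> S \<Longrightarrow> c \<in> tuples M l \<Longrightarrow> has_at_least (defset M (\<theta>\<^sub>1 m) c) (Kf m) \<Longrightarrow>
     has_at_least (defset M (\<theta>\<^sub>2 m) c) (Kf m) \<Longrightarrow>
     \<not> (\<forall>x\<in>defset M (\<theta>\<^sub>1 m) c. \<forall>y\<in>defset M (\<theta>\<^sub>2 m) c. edge x y)"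
    by metis
  \<comment> \<open>A sum of naturals dominates each summand, so \<open>K\<close> works for all
    gaps.\<close>
  define K where "K = sum Kf S"
  have K: "Kf m \<le> K" if "m \<in> S" for m
    unfolding K_def using that S by (intro member_le_sum) auto
  \<comment> \<open>\<open>Suc (card T)\<close> blocks of length \<open>Suc K\<close>. The block
    starts other than 0 are for the kept elements, and the \<open>K\<close> positions after a block
    start are for a gap.\<close>
  define N1 where "N1 = Suc (card T) * Suc K"
  obtain R where R: "\<forall>c :: nat \<Rightarrow> 'a. \<exists>H\<subseteq>{..<R}. card H = N1 \<and> indisc_on M \<Delta> H c"
    by (rule ramsey_indisc[OF \<Delta>(1), of N1 M])
  \<comment> \<open>\<open>R\<close> is the size needed for Ramsey's theorem in \<open>C\<close>,
    the other number the size needed to find an element of \<open>B\<close> outside all sets of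
    common neighbours.\<close>
  obtain B C where BC: "B \<subseteq> Dom M" "C \<subseteq> Dom M" "\<forall>x\<in>B. \<forall>y\<in>C. edge x y"
    and big: "has_at_least B (max R (Suc (card S * K)))" "has_at_least C (max R (Suc (card S * K)))"
    using rich unfolding finite_rectangles_def by meson
  have B: "has_at_least B (Suc (card S * K))" by (rule has_at_least_mono[OF big(1)]) simp
  have "has_at_least C R" by (rule has_at_least_mono[OF big(2)]) simp
  then obtain cs where cs: "inj_on cs {..<R}" "cs ` {..<R} \<subseteq> C"
    unfolding has_at_least_iff by blast
  obtain H where H: "H \<subseteq> {..<R}" "card H = N1" "indisc_on M \<Delta> H cs"
    using R[THEN spec, of cs] by blast
  have finH: "finite H" using H(1) by (rule finite_subset) simp
  define h where "h i = sorted_list_of_set H ! i" for i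
  have hH: "h i \<in> H" if "i < N1" for i
    using that H(2) finH unfolding h_def by (metis length_sorted_list_of_set nth_mem set_sorted_list_of_set)
  have h_mono: "h i < h j" if "i < j" "j < N1" for i j
    unfolding h_def using that H(2) strict_sorted_list_of_set[of H]
    by (intro sorted_wrt_nth_less[where P = "(<)"]) auto
  define rank where "rank q = card {t \<in> T. t < q}" for q
  have rank_le: "rank q \<le> card T" for q
    unfolding rank_def using T by (intro card_mono) auto
  have rank_mono: "rank q \<le> rank q'" if "q < q'" for q q'
    unfolding rank_def using T that by (intro card_mono) auto
  have rank_less: "rank q < rank q'" if "q < q'" "q \<in> T" for q q'
    unfolding rank_def using T that by (intro psubset_card_mono) auto
  \<comment> \<open>For a gap \<open>m\<close>, \<open>G j\<close> maps \<open>insert m T\<close>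
    increasingly to positions and sends \<open>m\<close> to the \<open>j\<close>-th filler of the
    block given by its rank in \<open>T\<close>.\<close>
  define G where "G j q = (if q \<in> T then Suc (rank q) * Suc K else Suc (rank q * Suc K + j))" for j q
  have G_less: "G j q < N1" if "j < K" for j q
  proof (cases "q \<in> T")
    case True
    then have "rank q < card T"
      unfolding rank_def using T by (intro psubset_card_mono) auto
    then have "Suc (Suc (rank q)) * Suc K \<le> N1"
      unfolding N1_def by (intro mult_le_mono1) simp
    then show ?thesis using True by (simp add: G_def)
  next
    case False
    have "Suc (rank q) * Suc K \<le> N1"
      unfolding N1_def using rank_le by (intro mult_le_mono1) simp
    then show ?thesis using False that by (simp add: G_def)
  qed
  have G_mono: "strict_mono_on (insert m T) (G j)" if "j < K" for m j
  proof (rule strict_mono_onI)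
    fix q q' assume qq: "q \<in> insert m T" "q' \<in> insert m T" "q < q'"
    show "G j q < G j q'"
    proof (cases "q \<in> T")
      case True
      then have "Suc (rank q) * Suc K \<le> rank q' * Suc K"
        using rank_less[OF qq(3)] by (intro mult_le_mono1) simp
      then show ?thesis using True by (auto simp: G_def)
    next
      case False
      then have "q' \<in> T" using qq by auto
      moreover have "rank q * Suc K \<le> rank q' * Suc K"
        using rank_mono[OF qq(3)] by (intro mult_le_mono1)
      ultimately show ?thesis using False that by (auto simp: G_def)
    qed
  qed
  obtain a0 where a0: "a0 \<in> Dom M" using wf by (auto simp: wf_struct_def)
  define c0 where "c0 q = (if q \<in> T then cs (h (Suc (rank q) * Suc K)) else a0)" for q
  have cs_Dom: "cs (h i) \<in> C" if "i < N1" for i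
    using hH[OF that] H(1) cs(2) by blast
  have c0_T: "c0 q \<in> C" if "q \<in> T" for q
  proof -
    have "rank q < card T"
      unfolding rank_def using T that by (intro psubset_card_mono) auto
    then have "Suc (Suc (rank q)) * Suc K \<le> N1"
      unfolding N1_def by (intro mult_le_mono1) simp
    then show ?thesis unfolding c0_def using that by (auto intro!: cs_Dom)
  qed
  have c0: "c0 q \<in> Dom M" for q
  proof (cases "q \<in> T")
    case True
    then show ?thesis using c0_T BC(2) by blast
  next
    case False
    then show ?thesis using a0 by (simp add: c0_def)
  qed
  define ps where "ps = d @ map (\<lambda>i. c0 (inv_into T pos i)) [0..<card T]"
  have ps: "ps \<in> tuples M l" using d c0 by (auto simp: ps_def tuples_def l_def)
  \<comment> \<open>The \<open>K\<close> fillers from \<open>H\<close> make the gap set large. If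
    the set of common neighbours were large too, the two would form a rectangle excluded by the
    choice of \<open>Kf m\<close>.\<close>
  have few: "\<not> has_at_least (defset M (\<theta>\<^sub>1 m) ps) K" if m: "m \<in> S" for m
  proof
    assume 1: "has_at_least (defset M (\<theta>\<^sub>1 m) ps) K"
    have "cs (h (G j m)) \<in> defset M (\<theta>\<^sub>2 m) ps" if j: "j < K" for j
    proof -
      have "indisc_on M \<Delta> (insert m T) (cs \<circ> (h \<circ> G j))"
        using G_less[OF j] hH h_mono strict_mono_onD[OF G_mono[OF j, of m]]
        by (intro indisc_on_reindex[OF H(3)]) (auto intro!: strict_mono_onI)
      moreover have "(c0(m := cs (h (G j m)))) q = (cs \<circ> (h \<circ> G j)) q" if "q \<in> insert m T" for q
        using that by (auto simp: c0_def G_def)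
      ultimately have "indisc_on M \<Delta> (insert m T) (c0(m := cs (h (G j m))))"
        using indisc_on_cong[of "insert m T" "c0(m := cs (h (G j m)))" "cs \<circ> (h \<circ> G j)" M \<Delta>] by blast
      then show ?thesis
        using cs_Dom[OF G_less[OF j]] BC(2)
        unfolding \<theta>\<^sub>2_def ps_def gap_defset[OF T pos \<Delta> mT[OF m]] by blast
    qed
    moreover have "inj_on (\<lambda>j. cs (h (G j m))) {..<K}"
    proof (rule inj_onI)
      fix i j assume ij: "i \<in> {..<K}" "j \<in> {..<K}" "cs (h (G i m)) = cs (h (G j m))"
      then have "h (G i m) = h (G j m)"
        using cs(1) hH G_less H(1) by (auto simp: inj_on_def subset_iff)
      then have "G i m = G j m"
        using h_mono G_less ij(1,2) by (metis lessThan_iff less_irrefl nat_neq_iff)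
      then show "i = j" using mT[OF m] by (simp add: G_def)
    qed
    ultimately have 2: "has_at_least (defset M (\<theta>\<^sub>2 m) ps) K"
      unfolding has_at_least_iff by blast
    have "\<forall>x\<in>defset M (\<theta>\<^sub>1 m) ps. \<forall>y\<in>defset M (\<theta>\<^sub>2 m) ps. edge x y"
      unfolding \<theta>\<^sub>1_def \<theta>\<^sub>2_def ps_def gap_defset[OF T pos \<Delta> mT[OF m]] common_nbr_defset[OF T pos \<Delta> mT[OF m]]
      by blast
    then show False
      using Kf[OF m ps] has_at_least_mono[OF 1 K[OF m]] has_at_least_mono[OF 2 K[OF m]] by blast
  qed
  have "\<exists>b\<in>B. \<forall>m\<in>S. b \<notin> defset M (\<theta>\<^sub>1 m) ps"
    by (rule has_at_least_diff_UN[OF B S few])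
  then obtain b where b: "b \<in> B" "\<forall>m\<in>S. b \<notin> defset M (\<theta>\<^sub>1 m) ps" by blast
  have "\<forall>m\<in>S. \<exists>y. y \<in> Dom M \<and> indisc_on M \<Delta> (insert m T) (c0(m := y)) \<and> \<not> edge b y"
  proof
    fix m assume m: "m \<in> S"
    then have "b \<notin> {x \<in> Dom M. \<forall>y\<in>Dom M. indisc_on M \<Delta> (insert m T) (c0(m := y)) \<longrightarrow> edge x y}"
      using b(2) common_nbr_defset[OF T pos \<Delta> mT[OF m], of c0] unfolding \<theta>\<^sub>1_def ps_def by metis
    then show "\<exists>y. y \<in> Dom M \<and> indisc_on M \<Delta> (insert m T) (c0(m := y)) \<and> \<not> edge b y"
      using b(1) BC(1) by blast
  qed
  from bchoice[OF this] obtain y where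
    y: "\<forall>m\<in>S. y m \<in> Dom M \<and> indisc_on M \<Delta> (insert m T) (c0(m := y m)) \<and> \<not> edge b (y m)" ..
  define c where "c q = (if q \<in> S then y q else c0 q)" for q
  show thesis
  proof (rule that[of b c])
    show "b \<in> Dom M" using b(1) BC(1) by blast
    show "range c \<subseteq> Dom M" using y c0 by (auto simp: c_def)
    show "\<forall>m\<in>S. indisc_on M \<Delta> (insert m T) c"
    proof
      fix m assume m: "m \<in> S"
      have "c q = (c0(m := y m)) q" if "q \<in> insert m T" for q
        using that m TS by (auto simp: c_def)
      then show "indisc_on M \<Delta> (insert m T) c"
        using y m indisc_on_cong[of "insert m T" c "c0(m := y m)" M \<Delta>] by blast
    qed
    show "\<forall>q\<in>T. edge b (c q)"
    proof
      fix q assume q: "q \<in> T"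
      then have "c q = c0 q" using TS by (auto simp: c_def)
      then show "edge b (c q)" using c0_T[OF q] b(1) BC(3) by simp
    qed
    show "\<forall>m\<in>S. \<not> edge b (c m)" using y by (simp add: c_def)
  qed
qed

end

text \<open>The gaps will sit at natural numbers. Moving any selection of indices to the next
  half-integer takes them off the gaps and preserves the order, so every pattern of gap and non-gap
  occurs along an increasing tuple.\<close>

lemma sorted_wrt_half_shift:
  "sorted_wrt (<) (map (\<lambda>i. if i \<in> S then of_nat i + 1 / 2 else of_nat i :: rat) [0..<n])"
proof -
  have "(if i \<in> S then of_nat i + 1 / 2 else of_nat i :: rat) < (if j \<in> S then of_nat j + 1 / 2 else of_nat j)"
    if "i < j" for i j
  proof -
    have "of_nat i + 1 \<le> (of_nat j :: rat)" using that by (metis Suc_leI of_nat_Suc of_nat_mono add.commute)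
    then show ?thesis by auto
  qed
  then show ?thesis by (simp add: sorted_wrt_map sorted_wrt_iff_nth_less)
qed

lemma half_notin_of_nat: "of_nat i + 1 / 2 \<noteq> (of_nat j :: rat)"
proof
  assume "of_nat i + 1 / 2 = (of_nat j :: rat)"
  then have "of_nat (2 * i + 1) = (of_nat (2 * j) :: rat)" by (simp add: field_simps)
  then have "2 * i + 1 = 2 * j" by (simp only: of_nat_eq_iff)
  then show False by presburger
qed

text \<open>In the limit model the edge relation to one parameter tuple fails exactly at the gaps 0,
  ..., \<open>n\<close>. Whether a pattern is realised is the same at all increasing tuples; at a
  suitably shifted tuple that parameter realises it. So all patterns are realised at 0, ...,
  \<open>n - 1\<close>, against the bound \<open>n\<close> from NIP.\<close>

theorem (in bipartite) distal_definable_rectangles: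
  assumes distal: "distal L M" and rich: finite_rectangles
  shows "\<exists>l \<theta>\<^sub>1 \<theta>\<^sub>2. formula L (Suc l) \<theta>\<^sub>1 \<and> formula L (Suc l) \<theta>\<^sub>2 \<and> definable_rectangles l \<theta>\<^sub>1 \<theta>\<^sub>2"
proof (rule ccontr)
  assume "\<not> ?thesis"
  then have thin: "\<not> definable_rectangles l \<theta>\<^sub>1 \<theta>\<^sub>2"
    if "formula L (Suc l) \<theta>\<^sub>1" "formula L (Suc l) \<theta>\<^sub>2" for l \<theta>\<^sub>1 \<theta>\<^sub>2 using that by blast
  have NIP: "NIP L M" using distal by (simp add: distal_def)
  obtain n where n: "\<And>xs. xs \<in> tuples M n \<Longrightarrow> holds M (unshattered_fm e (Suc k) n) xs"
    by (rule NIP_unshattered[OF NIP e]) blast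
  define u where "u = unshattered_fm e (Suc k) n"
  have u: "formula L n u" unfolding u_def by (rule formula_unshattered_fm[OF e])
  \<comment> \<open>The points 0, ..., \<open>n - 1\<close> are tested for shattering; with
    \<open>n\<close> included, \<open>S\<close> contains 0 for every \<open>n\<close>.\<close>
  define S where "S = (of_nat ` {..n} :: rat set)"
  have S: "finite S" "0 \<in> S" by (auto simp: S_def image_iff intro: bexI[of _ 0])
  \<comment> \<open>Variables 0, ..., \<open>k\<close> are reserved for \<open>b\<close> and
    \<open>d\<close>.\<close>
  define enc where "enc q = Suc (k + to_nat q)" for q :: rat
  have inj_enc: "inj_on enc J" for J by (auto simp: enc_def inj_on_def)
  define edge_fm where "edge_fm q = inst e (enc q # [0..<Suc k])" for q
  have sat_edge: "sat N v (edge_fm q) \<longleftrightarrow> holds N e (v (enc q) # map v [0..<Suc k])"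
    for N :: "('f, 'r, 'z) struct" and v q
    using sat_inst[of L "enc q # [0..<Suc k]" e N v] e by (simp add: edge_fm_def enc_def del: upt_Suc)
  define nats where "nats = map (\<lambda>i. enc (of_nat i)) [0..<n]"
  have nats: "length nats = n" "distinct nats"
    by (auto simp: nats_def distinct_map enc_def inj_on_def)
  define all :: "(nat \<times> ('f, 'r) fm) set" where "all = {(r, p). formula L r p}"
  \<comment> \<open>The conditions for compactness: indiscernibility after filling any single gap,
    edges off the gaps, no edges at the gaps, and the shattering bound. The full set is
    \<open>\<Gamma> all (- S)\<close>; its finite parts lie in sets of the same shape with finite
    arguments.\<close>
  define \<Gamma> where "\<Gamma> \<Delta> T = (\<Union>m\<in>S. indisc_fms enc \<Delta> (insert m T)) \<union> edge_fm ` T \<union>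
     (\<lambda>m. Neg (edge_fm m)) ` S \<union> {inst u nats}" for \<Delta> T
  have \<Gamma>_E: thesis if "p \<in> \<Gamma> \<Delta> T"
    "\<And>m. m \<in> S \<Longrightarrow> p \<in> indisc_fms enc \<Delta> (insert m T) \<Longrightarrow> thesis"
    "\<And>q. q \<in> T \<Longrightarrow> p = edge_fm q \<Longrightarrow> thesis" "\<And>m. m \<in> S \<Longrightarrow> p = Neg (edge_fm m) \<Longrightarrow> thesis"
    "p = inst u nats \<Longrightarrow> thesis" for \<Delta> T p thesis
  proof -
    from that(1) have "(\<exists>m\<in>S. p \<in> indisc_fms enc \<Delta> (insert m T)) \<or> (\<exists>q\<in>T. p = edge_fm q) \<or>
      (\<exists>m\<in>S. p = Neg (edge_fm m)) \<or> p = inst u nats"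
      by (simp only: \<Gamma>_def Un_iff UN_iff image_iff singleton_iff disj_assoc)
    then show thesis
      by (elim disjE bexE) (rule that(2), assumption+, rule that(3), assumption+,
          rule that(4), assumption+, rule that(5), assumption)
  qed
  have \<Gamma>_mono: "\<Gamma> \<Delta> T \<subseteq> \<Gamma> \<Delta>' T'" if "\<Delta> \<subseteq> \<Delta>'" "T \<subseteq> T'" for \<Delta> T \<Delta>' T'
  proof -
    have "indisc_fms enc \<Delta> (insert m T) \<subseteq> indisc_fms enc \<Delta>' (insert m T')" for m
      using that by (intro indisc_fms_mono) auto
    then show ?thesis using that(2) unfolding \<Gamma>_def by blast
  qed
  have wf_\<Gamma>: "wf_fm L p" if "p \<in> \<Gamma> all (- S)" for p
    using that wf_indisc_fms[of all L p enc] e u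
    by (auto simp: \<Gamma>_def all_def edge_fm_def formula_def)
  \<comment> \<open>A single condition mentions finitely many indices and at most one formula from
    \<open>all\<close>.\<close>
  have one: "\<exists>\<Delta> T. finite \<Delta> \<and> finite T \<and> \<Delta> \<subseteq> all \<and> T \<subseteq> - S \<and> p \<in> \<Gamma> \<Delta> T" if "p \<in> \<Gamma> all (- S)" for p
  proof -
    show ?thesis
    proof (rule \<Gamma>_E[OF that])
      fix m assume m: "m \<in> S" and p: "p \<in> indisc_fms enc all (insert m (- S))"
      from p obtain "is" js p' where eq: "p = Iff (inst p' (map enc is)) (inst p' (map enc js))"
        and c: "sorted_wrt (<) is" "sorted_wrt (<) js" "length is = length js" "set is \<subseteq> insert m (- S)"
          "set js \<subseteq> insert m (- S)" "(length is, p') \<in> all"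
        unfolding indisc_fms_def mem_Collect_eq by (elim exE conjE)
      let ?T = "(set is \<union> set js) - {m}"
      have "set is \<subseteq> insert m ?T" "set js \<subseteq> insert m ?T" by auto
      then have "p \<in> indisc_fms enc {(length is, p')} (insert m ?T)"
        unfolding indisc_fms_def mem_Collect_eq using eq c(1-3) by blast
      then have "p \<in> \<Gamma> {(length is, p')} ?T" using m unfolding \<Gamma>_def by blast
      then show ?thesis using c(4-6)
        by (intro exI[of _ "{(length is, p')}"] exI[of _ ?T]) auto
    next
      fix q assume "q \<in> - S" "p = edge_fm q"
      then show ?thesis by (intro exI[of _ "{}"] exI[of _ "{q}"]) (simp add: \<Gamma>_def)
    next
      fix m assume "m \<in> S" "p = Neg (edge_fm m)"
      then show ?thesis by (intro exI[of _ "{}"]) (simp add: \<Gamma>_def)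
    next
      assume "p = inst u nats"
      then show ?thesis by (intro exI[of _ "{}"]) (simp add: \<Gamma>_def)
    qed
  qed
  have directed: "\<exists>\<Delta> T. finite \<Delta> \<and> finite T \<and> \<Delta> \<subseteq> all \<and> T \<subseteq> - S \<and> F \<subseteq> \<Gamma> \<Delta> T"
    if "finite F" "F \<subseteq> \<Gamma> all (- S)" for F
    using that
  proof (induction rule: finite_induct)
    case empty
    show ?case by (intro exI[of _ "{}"]) simp
  next
    case (insert p F)
    then obtain \<Delta> T where 1: "finite \<Delta>" "finite T" "\<Delta> \<subseteq> all" "T \<subseteq> - S" "F \<subseteq> \<Gamma> \<Delta> T" by auto
    obtain \<Delta>' T' where 2: "finite \<Delta>'" "finite T'" "\<Delta>' \<subseteq> all" "T' \<subseteq> - S" "p \<in> \<Gamma> \<Delta>' T'"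
      using one[of p] insert.prems by auto
    have "\<Gamma> \<Delta> T \<subseteq> \<Gamma> (\<Delta> \<union> \<Delta>') (T \<union> T')" "\<Gamma> \<Delta>' T' \<subseteq> \<Gamma> (\<Delta> \<union> \<Delta>') (T \<union> T')"
      by (rule \<Gamma>_mono, simp, simp)+
    then have "insert p F \<subseteq> \<Gamma> (\<Delta> \<union> \<Delta>') (T \<union> T')" using 1 2 by blast
    then show ?case using 1 2 by (intro exI[of _ "\<Delta> \<union> \<Delta>'"] exI[of _ "T \<union> T'"]) simp
  qed
  have finsat: "\<exists>w. range w \<subseteq> Dom M \<and> (\<forall>p\<in>F. sat M w p)" if F: "finite F" "F \<subseteq> \<Gamma> all (- S)" for F
  proof -
    obtain \<Delta> T where \<Delta>T: "finite \<Delta>" "finite T" "\<Delta> \<subseteq> all" "T \<subseteq> - S" "F \<subseteq> \<Gamma> \<Delta> T"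
      using directed[OF F] by (elim exE conjE)
    have disj: "T \<inter> S = {}" using \<Delta>T(4) by blast
    obtain b and c :: "rat \<Rightarrow> 'a" where bc: "b \<in> Dom M" "range c \<subseteq> Dom M"
      "\<forall>m\<in>S. indisc_on M \<Delta> (insert m T) c" "\<forall>q\<in>T. edge b (c q)" "\<forall>m\<in>S. \<not> edge b (c m)"
      by (rule finite_approximation[OF rich thin \<Delta>T(2) S(1) disj \<Delta>T(1) \<Delta>T(3)[unfolded all_def]])
    define w where "w i = (if i = 0 then b else if i \<le> k then d ! (i - 1) else c (from_nat (i - Suc k)))" for i
    have w_enc: "w \<circ> enc = c" by (auto simp: w_def enc_def)
    have w_bd: "map w [0..<Suc k] = b # d"
      using d by (intro nth_equalityI) (auto simp: w_def tuples_def nth_Cons' simp del: upt_Suc)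
    have w_Dom: "range w \<subseteq> Dom M"
    proof -
      have "d ! (i - 1) \<in> Dom M" if "i \<noteq> 0" "i \<le> k" for i
        using d that nth_mem[of "i - 1" d] by (auto simp: tuples_def)
      then show ?thesis using bc(1,2) by (auto simp: w_def)
    qed
    have edge_w: "sat M w (edge_fm q) \<longleftrightarrow> edge b (c q)" for q
      using w_enc by (auto simp: sat_edge w_bd edge_def simp del: upt_Suc)
    have "sat M w p" if "p \<in> \<Gamma> \<Delta> T" for p
    proof (rule \<Gamma>_E[OF that])
      fix m assume m: "m \<in> S" and p: "p \<in> indisc_fms enc \<Delta> (insert m T)"
      have "indisc_on M \<Delta> (insert m T) (w \<circ> enc)"
        unfolding w_enc using bc(3) m by (rule bspec)
      then show ?thesis
        using sat_indisc_fms[OF \<Delta>T(3)[unfolded all_def] inj_enc, of "insert m T" M w] p by blast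
    next
      assume p: "p = inst u nats"
      have "map w nats \<in> tuples M n" using w_Dom nats(1) by (auto simp: tuples_def)
      then show ?thesis using n sat_inst[of L nats u M w] u nats by (simp add: p u_def)
    qed (use bc(4,5) edge_w in simp_all)
    then show ?thesis using w_Dom \<Delta>T(5) by blast
  qed
  obtain N :: "('f, 'r, ('f, 'r, 'a) univ) struct" and v where N: "wf_struct L N" "elem_equiv L M N"
    and v: "range v \<subseteq> Dom N" and sat_\<Gamma>: "\<forall>p\<in>\<Gamma> all (- S). sat N v p"
    by (rule compactness[OF wf wf_\<Gamma> finsat])
  note sat = bspec[OF sat_\<Gamma>]
  define c where "c = v \<circ> enc"
  have c_Dom: "range c \<subseteq> Dom N" using v by (auto simp: c_def)
  define ys where "ys = map v [0..<Suc k]"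
  have ys: "ys \<in> tuples N (Suc k)" using v by (auto simp: ys_def tuples_def simp del: upt_Suc)
  have indisc_S: "indisc_on N all (insert m (- S)) c" if "m \<in> S" for m
  proof -
    have "\<forall>p\<in>indisc_fms enc all (insert m (- S)). sat N v p"
      using that by (intro ballI sat) (auto simp: \<Gamma>_def)
    then show ?thesis
      using sat_indisc_fms[of all L enc "insert m (- S)" N v] inj_enc unfolding all_def c_def by blast
  qed
  have "indisc_on N all (insert m (- S)) c" for m
  proof (cases "m \<in> S")
    case False
    \<comment> \<open>For \<open>m\<close> outside \<open>S\<close> nothing is added to
      \<open>- S\<close>, so the case of the gap 0 is enough.\<close>
    then show ?thesis by (intro indisc_on_subset[OF indisc_S[OF S(2)]]) auto
  qed (rule indisc_S)
  then have indisc: "indisc_on N all UNIV c"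
    unfolding all_def by (intro distal_insert_all[OF distal N c_Dom S(1)])
  have edge_c: "holds N e (c q # ys) \<longleftrightarrow> q \<notin> S" for q
  proof (cases "q \<in> S")
    case True
    then have "sat N v (Neg (edge_fm q))" by (intro sat) (auto simp: \<Gamma>_def)
    then show ?thesis using True by (simp add: sat_edge ys_def c_def del: upt_Suc)
  next
    case False
    then have "sat N v (edge_fm q)" by (intro sat) (auto simp: \<Gamma>_def)
    then show ?thesis using False by (simp add: sat_edge ys_def c_def del: upt_Suc)
  qed
  have "sat N v (inst u nats)" by (intro sat) (simp add: \<Gamma>_def)
  then have "holds N u (map v nats)" using sat_inst[of L nats u N v] u nats by simp
  also have "map v nats = map c (map of_nat [0..<n])" by (simp add: nats_def c_def)
  \<comment> \<open>\<open>A\<close> is a pattern missing at the natural numbers, hence by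
    indiscernibility at every increasing \<open>n\<close>-tuple of indices.\<close>
  finally obtain A where A: "A \<subseteq> {..<n}" "\<not> holds N (pattern_fm e (Suc k) n A) (map c (map of_nat [0..<n]))"
    unfolding u_def holds_unshattered_fm by blast
  \<comment> \<open>Exactly the indices in \<open>A\<close> are moved off the gaps, so
    \<open>ys\<close> realises the pattern \<open>A\<close> along \<open>js\<close>.\<close>
  define js where "js = map (\<lambda>i. if i \<in> A then of_nat i + 1 / 2 else of_nat i :: rat) [0..<n]"
  have len_js: "length js = n" by (simp add: js_def)
  have "sorted_wrt (<) (map of_nat [0..<n] :: rat list)"
    using sorted_wrt_half_shift[of "{}" n] by simp
  then have "holds N (pattern_fm e (Suc k) n A) (map c (map of_nat [0..<n])) \<longleftrightarrow>
      holds N (pattern_fm e (Suc k) n A) (map c js)"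
    using sorted_wrt_half_shift[of A n] formula_pattern_fm[OF e]
    by (intro indisc_onD[OF indisc]) (auto simp: js_def all_def)
  moreover have "holds N e (map c js ! i # ys) \<longleftrightarrow> i \<in> A" if "i < n" for i
  proof -
    have "js ! i \<notin> S \<longleftrightarrow> i \<in> A"
      using that half_notin_of_nat by (auto simp: js_def S_def)
    then show ?thesis using that edge_c[of "js ! i"] by (simp add: len_js)
  qed
  then have "holds N (pattern_fm e (Suc k) n A) (map c js)"
    using holds_pattern_fm[OF e, of "map c js" n N A] ys len_js by (auto simp del: nth_map)
  ultimately show False using A(2) by blast
qed

section \<open>The product relation of the group and the two conclusions\<close>

definition prod_fm :: "'f \<Rightarrow> nat \<Rightarrow> ('f, 'r) fm \<Rightarrow> ('f, 'r) fm" where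
  "prod_fm mu k \<phi> = (let z = Suc (Suc k) in
     Exists z (Conj (Equal (Var z) (App mu [Var 1, Var 0])) (inst \<phi> (z # [2..<z]))))"

lemma formula_prod_fm:
  assumes "formula L (Suc k) \<phi>" "mu \<in> fsyms L" "farity L mu = 2"
  shows "formula L (Suc (Suc k)) (prod_fm mu k \<phi>)"
proof -
  have "fv (inst \<phi> (Suc (Suc k) # [2..<Suc (Suc k)])) \<subseteq> set (Suc (Suc k) # [2..<Suc (Suc k)])"
    using assms(1) by (intro fv_inst[of L]) (simp_all del: upt_Suc)
  then have "fv (inst \<phi> (Suc (Suc k) # [2..<Suc (Suc k)])) \<subseteq> {..Suc (Suc k)}"
    by (rule order_trans) auto
  then show ?thesis using assms by (auto simp: formula_def prod_fm_def Let_def simp del: upt_Suc)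
qed

text \<open>Since \<open>inst\<close> substitutes variables and not terms, \<open>prod_fm\<close>
  names the product by a quantified variable; closure of the domain under the product supplies its
  witness.\<close>

lemma holds_prod_fm:
  assumes "formula L (Suc k) \<phi>" "length d = k" "fint M mu [x, y] \<in> Dom M"
  shows "holds M (prod_fm mu k \<phi>) (y # x # d) \<longleftrightarrow> fint M mu [x, y] \<in> defset M \<phi> d"
proof -
  let ?z = "Suc (Suc k)"
  let ?v = "\<lambda>a. (\<lambda>i. (y # x # d) ! i)(?z := a)"
  have "map (?v a) [2..<?z] = d" for a
    using assms(2) by (intro nth_equalityI) (auto simp: nth_Cons' numeral_2_eq_2 simp del: upt_Suc)
  then have "sat M (?v a) (inst \<phi> (?z # [2..<?z])) \<longleftrightarrow> holds M \<phi> (a # d)" for a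
    using sat_inst[of L "?z # [2..<?z]" \<phi> M "?v a"] assms(1) by (simp del: upt_Suc)
  then show ?thesis
    using assms(3) unfolding prod_fm_def Let_def holds_def[of M "Exists _ _"] sat.simps defset_def by auto
qed

theorem theorem4p6:
  fixes L :: "('f, 'r) lang"
    and M :: "('f, 'r, 'a) struct"
    and mu :: 'f
    and G :: "('a, 'b) monoid_scheme"
    and k :: nat
    and \<phi> :: "('f, 'r) fm"
    and d :: "'a list"
  assumes "group_expansion L M mu G"
    and "distal L M"
    and "formula L (Suc k) \<phi>"
    and "d \<in> tuples M k"
  shows "(finitary_productset G (defset M \<phi> d) \<longrightarrow>
            definable_finitary_productset L M G (defset M \<phi> d)) \<and>
         (eliminates_exists_infinity L M \<longrightarrow>
            (\<exists>n::nat. (\<exists>B C. B \<subseteq> carrier G \<and> C \<subseteq> carrier G \<and>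
                 has_at_least B n \<and> has_at_least C n \<and> B <#>\<^bsub>G\<^esub> C \<subseteq> defset M \<phi> d) \<longrightarrow>
               definable_productset L M G (defset M \<phi> d)))"
proof -
  let ?P = "defset M \<phi> d"
  have G: "group G" and wf: "wf_struct L M" and Dom: "Dom M = carrier G"
    and mu: "mu \<in> fsyms L" "farity L mu = 2"
    and mult: "\<And>x y. x \<in> carrier G \<Longrightarrow> y \<in> carrier G \<Longrightarrow> fint M mu [x, y] = x \<otimes>\<^bsub>G\<^esub> y"
    using assms(1) by (auto simp: group_expansion_def)
  interpret bipartite L M k "prod_fm mu k \<phi>" d
    by (rule bipartite.intro[OF wf formula_prod_fm[OF assms(3) mu] assms(4)])
  have edge: "edge x y \<longleftrightarrow> x \<otimes>\<^bsub>G\<^esub> y \<in> ?P" if "x \<in> carrier G" "y \<in> carrier G" for x y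
  proof -
    have "x \<otimes>\<^bsub>G\<^esub> y \<in> Dom M"
      using G that by (simp add: Dom group.is_monoid monoid.m_closed)
    then show ?thesis
      using holds_prod_fm[OF assms(3), of d M mu x y] assms(4) mult[OF that]
      by (simp add: edge_def tuples_def)
  qed
  have set_mult: "B <#>\<^bsub>G\<^esub> C \<subseteq> ?P \<longleftrightarrow> (\<forall>x\<in>B. \<forall>y\<in>C. edge x y)"
    if "B \<subseteq> carrier G" "C \<subseteq> carrier G" for B C
  proof -
    have "B <#>\<^bsub>G\<^esub> C \<subseteq> ?P \<longleftrightarrow> (\<forall>x\<in>B. \<forall>y\<in>C. x \<otimes>\<^bsub>G\<^esub> y \<in> ?P)"
      unfolding set_mult_def by blast
    also have "\<dots> \<longleftrightarrow> (\<forall>x\<in>B. \<forall>y\<in>C. edge x y)"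
      using that by (intro ball_cong refl edge[symmetric]) auto
    finally show ?thesis .
  qed
  have sub: "defset M \<theta> c \<subseteq> carrier G" for \<theta> c
    by (auto simp: defset_def Dom)
  have a: "definable_finitary_productset L M G ?P" if fin: "finitary_productset G ?P"
  proof -
    have "finite_rectangles"
      using fin unfolding finitary_productset_def finite_rectangles_def Dom by (metis set_mult)
    from distal_definable_rectangles[OF assms(2) this] obtain l \<theta>\<^sub>1 \<theta>\<^sub>2
      where \<theta>: "formula L (Suc l) \<theta>\<^sub>1" "formula L (Suc l) \<theta>\<^sub>2" "definable_rectangles l \<theta>\<^sub>1 \<theta>\<^sub>2" by blast
    \<comment> \<open>The common parameter tuple of the two formulas serves as both
      \<open>c\<^sub>1\<close> and \<open>c\<^sub>2\<close>.\<close>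
    then show ?thesis
      unfolding definable_finitary_productset_def definable_rectangles_def set_mult[OF sub sub] by blast
  qed
  have b: "definable_productset L M G ?P"
    if elim: "eliminates_exists_infinity L M" and dfp: "definable_finitary_productset L M G ?P"
  proof -
    obtain l \<theta>\<^sub>1 \<theta>\<^sub>2 where \<theta>: "formula L (Suc l) \<theta>\<^sub>1" "formula L (Suc l) \<theta>\<^sub>2"
      and rect: "\<And>n. \<exists>c\<^sub>1\<in>tuples M l. \<exists>c\<^sub>2\<in>tuples M l. has_at_least (defset M \<theta>\<^sub>1 c\<^sub>1) n \<and>
        has_at_least (defset M \<theta>\<^sub>2 c\<^sub>2) n \<and> defset M \<theta>\<^sub>1 c\<^sub>1 <#>\<^bsub>G\<^esub> defset M \<theta>\<^sub>2 c\<^sub>2 \<subseteq> ?P"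
      using dfp unfolding definable_finitary_productset_def by blast
    obtain n\<^sub>1 where n1: "\<forall>c\<in>tuples M l. has_at_least (defset M \<theta>\<^sub>1 c) n\<^sub>1 \<longrightarrow> infinite (defset M \<theta>\<^sub>1 c)"
      using elim \<theta>(1) unfolding eliminates_exists_infinity_def by blast
    obtain n\<^sub>2 where n2: "\<forall>c\<in>tuples M l. has_at_least (defset M \<theta>\<^sub>2 c) n\<^sub>2 \<longrightarrow> infinite (defset M \<theta>\<^sub>2 c)"
      using elim \<theta>(2) unfolding eliminates_exists_infinity_def by blast
    obtain c\<^sub>1 c\<^sub>2 where c: "c\<^sub>1 \<in> tuples M l" "c\<^sub>2 \<in> tuples M l"
      and big: "has_at_least (defset M \<theta>\<^sub>1 c\<^sub>1) (max n\<^sub>1 n\<^sub>2)" "has_at_least (defset M \<theta>\<^sub>2 c\<^sub>2) (max n\<^sub>1 n\<^sub>2)"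
      and prod: "defset M \<theta>\<^sub>1 c\<^sub>1 <#>\<^bsub>G\<^esub> defset M \<theta>\<^sub>2 c\<^sub>2 \<subseteq> ?P"
      using rect[of "max n\<^sub>1 n\<^sub>2"] by blast
    have "infinite (defset M \<theta>\<^sub>1 c\<^sub>1)" "infinite (defset M \<theta>\<^sub>2 c\<^sub>2)"
      using n1 n2 c has_at_least_mono[OF big(1)] has_at_least_mono[OF big(2)] by simp_all
    moreover have "definable L M (defset M \<theta>\<^sub>1 c\<^sub>1)" "definable L M (defset M \<theta>\<^sub>2 c\<^sub>2)"
      using c \<theta> unfolding definable_def by blast+
    ultimately show ?thesis using prod unfolding definable_productset_def by blast
  qed
  show ?thesis
  proof (intro conjI impI)
    show "definable_finitary_productset L M G ?P" if "finitary_productset G ?P" using a that .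
    assume elim: "eliminates_exists_infinity L M"
    \<comment> \<open>With the finitary property any \<open>n\<close> will do by (a) and
      \<open>b\<close>. Without it some \<open>n\<close> admits no such \<open>B\<close> and
      \<open>C\<close>, and for that \<open>n\<close> the implication is vacuous.\<close>
    show "\<exists>n::nat. (\<exists>B C. B \<subseteq> carrier G \<and> C \<subseteq> carrier G \<and> has_at_least B n \<and> has_at_least C n \<and>
        B <#>\<^bsub>G\<^esub> C \<subseteq> ?P) \<longrightarrow> definable_productset L M G ?P"
    proof (cases "finitary_productset G ?P")
      case True
      then show ?thesis using b[OF elim a] by blast
    next
      case False
      then show ?thesis unfolding finitary_productset_def by blast
    qed
  qed
qed

end
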